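(* Let $F$ be a field, $R$ a Hopf $F$-algebra which is finitely generated as an $F$-algebra, and $T=R[x;\sigma,\delta]$ a Hopf Ore extension of $R$ such that $S(x)=\alpha x+\beta$ for some $\alpha,\beta\in R$ with $\alpha$ a unit of $R$. Then $\mathrm{GKdim}\,T=\mathrm{GKdim}\,R+1$.
   Context: Hopf algebras have bijective antipode. A Hopf Ore extension of $R$ is a Hopf $F$-algebra $T$ containing $R$ as a Hopf subalgebra with $T=R[x;\sigma,\delta]$ (skew polynomial algebra: $xr-\sigma(r)x=\delta(r)$, $\sigma$ an automorphism, $\delta$ a $\sigma$-derivation) and $\Delta(x)=a\otimes x+x\otimes b+v(x\otimes x)+w$ for some $a,b\in R$, $v,w\in R\otimes R$. GKdim denotes Gelfand–Kirillov dimension. *)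

theory Defs
  imports Main "HOL-Library.Extended_Real" "HOL-Library.Liminf_Limsup"
begin

definition f_algebra :: "('f::field \<Rightarrow> 'a::ring_1 \<Rightarrow> 'a) \<Rightarrow> bool" where
  "f_algebra sc \<longleftrightarrow> vector_space sc \<and>
     (\<forall>k x y. sc k (x * y) = sc k x * y) \<and> (\<forall>k x y. sc k (x * y) = x * sc k y)"

text \<open>Elements of the tensor product T \<otimes> T over F are represented by finite lists of
 pairs (sum of a_i \<otimes> b_i). Two representatives denote the same tensor iff every
 F-bilinear form takes the same value on them (F-valued bilinear forms separate
 the points of a tensor product of vector spaces over a field). Likewise for T\<otimes>T\<otimes>T.\<close>
definition bilin :: "('f::field \<Rightarrow> 'a::ring_1 \<Rightarrow> 'a) \<Rightarrow> ('a \<Rightarrow> 'a \<Rightarrow> 'f) \<Rightarrow> bool" where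
  "bilin sc \<phi> \<longleftrightarrow>
     (\<forall>a b c. \<phi> (a + b) c = \<phi> a c + \<phi> b c) \<and> (\<forall>a b c. \<phi> c (a + b) = \<phi> c a + \<phi> c b) \<and>
     (\<forall>k a c. \<phi> (sc k a) c = k * \<phi> a c) \<and> (\<forall>k a c. \<phi> c (sc k a) = k * \<phi> c a)"

definition trilin :: "('f::field \<Rightarrow> 'a::ring_1 \<Rightarrow> 'a) \<Rightarrow> ('a \<Rightarrow> 'a \<Rightarrow> 'a \<Rightarrow> 'f) \<Rightarrow> bool" where
  "trilin sc \<psi> \<longleftrightarrow>
     (\<forall>a b c d. \<psi> (a + b) c d = \<psi> a c d + \<psi> b c d) \<and>
     (\<forall>a b c d. \<psi> c (a + b) d = \<psi> c a d + \<psi> c b d) \<and>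
     (\<forall>a b c d. \<psi> c d (a + b) = \<psi> c d a + \<psi> c d b) \<and>
     (\<forall>k a c d. \<psi> (sc k a) c d = k * \<psi> a c d) \<and>
     (\<forall>k a c d. \<psi> c (sc k a) d = k * \<psi> c a d) \<and>
     (\<forall>k a c d. \<psi> c d (sc k a) = k * \<psi> c d a)"

definition teq :: "('f::field \<Rightarrow> 'a::ring_1 \<Rightarrow> 'a) \<Rightarrow> ('a \<times> 'a) list \<Rightarrow> ('a \<times> 'a) list \<Rightarrow> bool" where
  "teq sc ts us \<longleftrightarrow> (\<forall>\<phi>. bilin sc \<phi> \<longrightarrow>
      (\<Sum>p\<leftarrow>ts. \<phi> (fst p) (snd p)) = (\<Sum>p\<leftarrow>us. \<phi> (fst p) (snd p)))"

definition teq3 :: "('f::field \<Rightarrow> 'a::ring_1 \<Rightarrow> 'a) \<Rightarrow> ('a \<times> 'a \<times> 'a) list \<Rightarrow> ('a \<times> 'a \<times> 'a) list \<Rightarrow> bool" where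
  "teq3 sc ts us \<longleftrightarrow> (\<forall>\<psi>. trilin sc \<psi> \<longrightarrow>
      (\<Sum>p\<leftarrow>ts. \<psi> (fst p) (fst (snd p)) (snd (snd p))) =
      (\<Sum>p\<leftarrow>us. \<psi> (fst p) (fst (snd p)) (snd (snd p))))"

definition tscale :: "('f::field \<Rightarrow> 'a::ring_1 \<Rightarrow> 'a) \<Rightarrow> 'f \<Rightarrow> ('a \<times> 'a) list \<Rightarrow> ('a \<times> 'a) list" where
  "tscale sc k ts = map (\<lambda>p. (sc k (fst p), snd p)) ts"

definition tmul :: "('a::ring_1 \<times> 'a) list \<Rightarrow> ('a \<times> 'a) list \<Rightarrow> ('a \<times> 'a) list" where
  "tmul ts us = concat (map (\<lambda>p. map (\<lambda>q. (fst p * fst q, snd p * snd q)) us) ts)"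

definition coL :: "('a \<Rightarrow> ('a \<times> 'a) list) \<Rightarrow> ('a \<times> 'a) list \<Rightarrow> ('a \<times> 'a \<times> 'a) list" where
  "coL D ts = concat (map (\<lambda>p. map (\<lambda>q. (fst q, snd q, snd p)) (D (fst p))) ts)"

definition coR :: "('a \<Rightarrow> ('a \<times> 'a) list) \<Rightarrow> ('a \<times> 'a) list \<Rightarrow> ('a \<times> 'a \<times> 'a) list" where
  "coR D ts = concat (map (\<lambda>p. map (\<lambda>q. (fst p, fst q, snd q)) (D (snd p))) ts)"

text \<open>Hopf F-algebra structure (comultiplication D, counit e, antipode S) on the
 whole type 'a; the antipode is required to be bijective (standing convention).\<close>
definition hopf_alg :: "('f::field \<Rightarrow> 'a::ring_1 \<Rightarrow> 'a) \<Rightarrow> ('a \<Rightarrow> ('a \<times> 'a) list) \<Rightarrow>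
    ('a \<Rightarrow> 'f) \<Rightarrow> ('a \<Rightarrow> 'a) \<Rightarrow> bool" where
  "hopf_alg sc D e S \<longleftrightarrow> f_algebra sc \<and>
     (\<forall>x y. teq sc (D (x + y)) (D x @ D y)) \<and>
     (\<forall>k x. teq sc (D (sc k x)) (tscale sc k (D x))) \<and>
     teq sc (D 1) [(1, 1)] \<and>
     (\<forall>x y. teq sc (D (x * y)) (tmul (D x) (D y))) \<and>
     (\<forall>x. teq3 sc (coL D (D x)) (coR D (D x))) \<and>
     (\<forall>x y. e (x + y) = e x + e y) \<and> (\<forall>k x. e (sc k x) = k * e x) \<and>
     e 1 = 1 \<and> (\<forall>x y. e (x * y) = e x * e y) \<and>
     (\<forall>x. (\<Sum>p\<leftarrow>D x. sc (e (fst p)) (snd p)) = x) \<and>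
     (\<forall>x. (\<Sum>p\<leftarrow>D x. sc (e (snd p)) (fst p)) = x) \<and>
     (\<forall>x y. S (x + y) = S x + S y) \<and> (\<forall>k x. S (sc k x) = sc k (S x)) \<and>
     (\<forall>x. (\<Sum>p\<leftarrow>D x. S (fst p) * snd p) = sc (e x) 1) \<and>
     (\<forall>x. (\<Sum>p\<leftarrow>D x. fst p * S (snd p)) = sc (e x) 1) \<and>
     bij S"

definition subalg :: "('f::field \<Rightarrow> 'a::ring_1 \<Rightarrow> 'a) \<Rightarrow> 'a set \<Rightarrow> bool" where
  "subalg sc A \<longleftrightarrow> 0 \<in> A \<and> 1 \<in> A \<and> (\<forall>x\<in>A. \<forall>y\<in>A. x + y \<in> A \<and> x * y \<in> A) \<and>
     (\<forall>k. \<forall>x\<in>A. sc k x \<in> A)"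

definition hopf_subalg :: "('f::field \<Rightarrow> 'a::ring_1 \<Rightarrow> 'a) \<Rightarrow> ('a \<Rightarrow> ('a \<times> 'a) list) \<Rightarrow>
    ('a \<Rightarrow> 'a) \<Rightarrow> 'a set \<Rightarrow> bool" where
  "hopf_subalg sc D S R \<longleftrightarrow> subalg sc R \<and> bij_betw S R R \<and>
     (\<forall>r\<in>R. \<exists>ts. set ts \<subseteq> R \<times> R \<and> teq sc (D r) ts)"

definition fin_gen :: "('f::field \<Rightarrow> 'a::ring_1 \<Rightarrow> 'a) \<Rightarrow> 'a set \<Rightarrow> bool" where
  "fin_gen sc A \<longleftrightarrow> (\<exists>G. finite G \<and> G \<subseteq> A \<and> A = \<Inter>{B. subalg sc B \<and> G \<subseteq> B})"

definition alg_aut_on :: "('f::field \<Rightarrow> 'a::ring_1 \<Rightarrow> 'a) \<Rightarrow> 'a set \<Rightarrow> ('a \<Rightarrow> 'a) \<Rightarrow> bool" where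
  "alg_aut_on sc R \<sigma> \<longleftrightarrow> bij_betw \<sigma> R R \<and> \<sigma> 1 = 1 \<and>
     (\<forall>r\<in>R. \<forall>s\<in>R. \<sigma> (r + s) = \<sigma> r + \<sigma> s \<and> \<sigma> (r * s) = \<sigma> r * \<sigma> s) \<and>
     (\<forall>k. \<forall>r\<in>R. \<sigma> (sc k r) = sc k (\<sigma> r))"

definition sigma_deriv_on :: "('f::field \<Rightarrow> 'a::ring_1 \<Rightarrow> 'a) \<Rightarrow> 'a set \<Rightarrow> ('a \<Rightarrow> 'a) \<Rightarrow> ('a \<Rightarrow> 'a) \<Rightarrow> bool" where
  "sigma_deriv_on sc R \<sigma> \<delta> \<longleftrightarrow> (\<forall>r\<in>R. \<delta> r \<in> R) \<and>
     (\<forall>r\<in>R. \<forall>s\<in>R. \<delta> (r + s) = \<delta> r + \<delta> s \<and> \<delta> (r * s) = \<sigma> r * \<delta> s + \<delta> r * s) \<and>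
     (\<forall>k. \<forall>r\<in>R. \<delta> (sc k r) = sc k (\<delta> r))"

definition ore_ext :: "'a::ring_1 set \<Rightarrow> ('a \<Rightarrow> 'a) \<Rightarrow> ('a \<Rightarrow> 'a) \<Rightarrow> 'a \<Rightarrow> bool" where
  "ore_ext R \<sigma> \<delta> x \<longleftrightarrow> (\<forall>r\<in>R. x * r - \<sigma> r * x = \<delta> r) \<and>
     (\<forall>t. \<exists>n c. (\<forall>i<n. c i \<in> R) \<and> t = (\<Sum>i<n. c i * x ^ i)) \<and>
     (\<forall>n c. (\<forall>i<n. c i \<in> R) \<and> (\<Sum>i<n. c i * x ^ i) = 0 \<longrightarrow> (\<forall>i<n. c i = 0))"

definition hopf_ore_ext :: "('f::field \<Rightarrow> 'a::ring_1 \<Rightarrow> 'a) \<Rightarrow> ('a \<Rightarrow> ('a \<times> 'a) list) \<Rightarrow>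
    ('a \<Rightarrow> 'f) \<Rightarrow> ('a \<Rightarrow> 'a) \<Rightarrow> 'a set \<Rightarrow> ('a \<Rightarrow> 'a) \<Rightarrow> ('a \<Rightarrow> 'a) \<Rightarrow> 'a \<Rightarrow> bool" where
  "hopf_ore_ext sc D e S R \<sigma> \<delta> x \<longleftrightarrow>
     hopf_alg sc D e S \<and> hopf_subalg sc D S R \<and>
     alg_aut_on sc R \<sigma> \<and> sigma_deriv_on sc R \<sigma> \<delta> \<and> ore_ext R \<sigma> \<delta> x \<and>
     (\<exists>a b v w. a \<in> R \<and> b \<in> R \<and> set v \<subseteq> R \<times> R \<and> set w \<subseteq> R \<times> R \<and>
        teq sc (D x) ([(a, x), (x, b)] @ map (\<lambda>p. (fst p * x, snd p * x)) v @ w))"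

definition powsp :: "('f::field \<Rightarrow> 'a::ring_1 \<Rightarrow> 'a) \<Rightarrow> 'a set \<Rightarrow> nat \<Rightarrow> 'a set" where
  "powsp sc V n = module.span sc {foldr (*) xs 1 | xs. length xs = n \<and> set xs \<subseteq> V}"

definition GKdim :: "('f::field \<Rightarrow> 'a::ring_1 \<Rightarrow> 'a) \<Rightarrow> 'a set \<Rightarrow> ereal" where
  "GKdim sc A = (SUP B \<in> {B. finite B \<and> B \<subseteq> A \<and> 1 \<in> B}.
     limsup (\<lambda>n. ereal (ln (real (vector_space.dim sc (powsp sc (module.span sc B) n))) / ln (real n))))"

end

theory Submission
  imports Defs "HOL-Analysis.Extended_Real_Limits" "HOL-Real_Asymp.Real_Asymp"
begin

text \<open>
  Write \<open>\<Delta>(x) = a \<otimes> x + x \<otimes> b + v(x \<otimes> x) + w\<close>. Comparing coefficients of powers of \<open>x\<close> in the antipode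
  axiom at \<open>x\<close> gives \<open>\<Sum> S(v\<^sub>1)v\<^sub>2 = 0\<close> and \<open>S(a) = -\<alpha>\<sigma>(b)\<close>; this is where the unit \<open>\<alpha>\<close> enters. With
  coassociativity at \<open>x\<close> it follows that \<open>a\<close> and \<open>b\<close> are units with inverses \<open>S(a)\<close> and \<open>S(b)\<close>, and
  that \<open>(\<epsilon> \<otimes> id)(v) = 0\<close>. Applying \<open>\<Delta>\<close> to \<open>xr = \<sigma>(r)x + \<delta>(r)\<close> then shows \<open>\<sigma>(r) = b \<tau>(r) b\<^sup>-\<^sup>1\<close>, where
  \<open>\<tau>(r) = \<Sum> \<epsilon>(\<sigma>(r\<^sub>1)) r\<^sub>2\<close> is a winding automorphism and hence locally finite. For the new variable
  \<open>y = b\<^sup>-\<^sup>1x\<close> (called \<open>xn\<close> below) the twisting automorphism is \<open>\<tau>\<close>; if \<open>V\<close> is a finite-dimensional \<open>\<tau>\<close>-stable generating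
  space of \<open>R\<close>, then \<open>(V + Fy)\<^sup>n \<subseteq> \<Sum>\<^bsub>i \<le> n\<^esub> V\<^bsup>cn\<^esup> y\<^sup>i\<close> for a constant \<open>c\<close>, which bounds the growth from
  above. The bound from below comes from \<open>V\<^sup>n x\<^sup>i \<subseteq> (V + Fx)\<^bsup>2n\<^esup>\<close> for \<open>i \<le> n\<close> and the freeness of \<open>T\<close>
  over \<open>R\<close>.
\<close>

section \<open>Sweedler sums in Hopf algebras\<close>

lemma sum_list_0: "(\<And>p. p \<in> set ts \<Longrightarrow> f p = 0) \<Longrightarrow> (\<Sum>p\<leftarrow>ts. f p) = (0::'b::monoid_add)"
  by (induction ts) auto

lemma sum_list_cong: "(\<And>p. p \<in> set ts \<Longrightarrow> f p = g p) \<Longrightarrow> (\<Sum>p\<leftarrow>ts. f p) = (\<Sum>p\<leftarrow>ts. g p)"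
  by (metis map_cong)

locale f_alg =
  fixes sc :: "'f::field \<Rightarrow> 'a::ring_1 \<Rightarrow> 'a"
  assumes f_algebra: "f_algebra sc"

sublocale f_alg \<subseteq> vector_space sc
  using f_algebra by (simp add: f_algebra_def)

context f_alg
begin

lemma mult_scale_left [simp]: "sc k a * b = sc k (a * b)"
  using f_algebra by (simp add: f_algebra_def)

lemma mult_scale_right [simp]: "a * sc k b = sc k (a * b)"
  using f_algebra unfolding f_algebra_def by metis

section \<open>Tensors tested against maps with values in the algebra\<close>

definition linear_form :: "('a \<Rightarrow> 'f) \<Rightarrow> bool" where
  "linear_form f \<longleftrightarrow> (\<forall>a b. f (a + b) = f a + f b) \<and> (\<forall>k a. f (sc k a) = k * f a)"

text \<open>Extend \<open>v\<close> to a basis and take the \<open>v\<close>-coordinate.\<close>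

lemma linear_form_separates:
  assumes "v \<noteq> 0"
  shows "\<exists>f. linear_form f \<and> f v \<noteq> 0"
proof -
  have ind: "independent {v}"
    using assms by simp
  let ?B = "extend_basis {v}"
  have B: "independent ?B" "span ?B = UNIV" "v \<in> ?B"
    using extend_basis_superset[OF ind] ind
    by (auto simp: independent_extend_basis span_extend_basis)
  have "linear_form (\<lambda>w. representation ?B w v)"
    unfolding linear_form_def using B by (simp add: representation_add representation_scale)
  moreover have "representation ?B v v \<noteq> 0"
    using representation_basis[OF B(1) B(3)] by simp
  ultimately show ?thesis
    by blast
qed

text \<open>\<open>teq\<close> tests tensors against scalar forms only, while the Hopf identities
  have values in T; this is the T-valued counterpart of \<open>bilin\<close>.\<close>

definition bilin_map :: "('a \<Rightarrow> 'a \<Rightarrow> 'a) \<Rightarrow> bool" where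
  "bilin_map B \<longleftrightarrow>
     (\<forall>a b c. B (a + b) c = B a c + B b c) \<and> (\<forall>a b c. B c (a + b) = B c a + B c b) \<and>
     (\<forall>k a c. B (sc k a) c = sc k (B a c)) \<and> (\<forall>k a c. B c (sc k a) = sc k (B c a))"

definition trilin_map :: "('a \<Rightarrow> 'a \<Rightarrow> 'a \<Rightarrow> 'a) \<Rightarrow> bool" where
  "trilin_map P \<longleftrightarrow>
     (\<forall>a b c d. P (a + b) c d = P a c d + P b c d) \<and>
     (\<forall>a b c d. P c (a + b) d = P c a d + P c b d) \<and>
     (\<forall>a b c d. P c d (a + b) = P c d a + P c d b) \<and>
     (\<forall>k a c d. P (sc k a) c d = sc k (P a c d)) \<and>
     (\<forall>k a c d. P c (sc k a) d = sc k (P c a d)) \<and>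
     (\<forall>k a c d. P c d (sc k a) = sc k (P c d a))"

lemma linear_form_0: "linear_form f \<Longrightarrow> f 0 = 0"
  unfolding linear_form_def by (metis add_cancel_right_left)

lemma linear_form_diff: "linear_form f \<Longrightarrow> f (a - b) = f a - f b"
  unfolding linear_form_def by (metis add_diff_cancel diff_add_cancel)

lemma linear_form_sum_list:
  "linear_form f \<Longrightarrow> f (\<Sum>p\<leftarrow>ts. g p) = (\<Sum>p\<leftarrow>ts. f (g p))"
  by (induction ts) (simp_all add: linear_form_0, simp add: linear_form_def)

text \<open>Composing \<open>B\<close> with a linear form gives a scalar bilinear form, and linear
  forms separate points. Hence the value of \<open>B\<close> on a tensor does not depend on the
  representing list.\<close>

lemma teq_bilin_map:
  assumes "teq sc ts us" "bilin_map B"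
  shows "(\<Sum>p\<leftarrow>ts. B (fst p) (snd p)) = (\<Sum>p\<leftarrow>us. B (fst p) (snd p))" (is "?l = ?r")
proof (rule ccontr)
  assume "?l \<noteq> ?r"
  then obtain f where f: "linear_form f" "f (?l - ?r) \<noteq> 0"
    using linear_form_separates[of "?l - ?r"] by auto
  have "bilin sc (\<lambda>s t. f (B s t))"
    using f(1) assms(2) unfolding bilin_def linear_form_def bilin_map_def by simp
  hence "f ?l = f ?r"
    using assms(1) unfolding teq_def linear_form_sum_list[OF f(1)] by blast
  thus False
    using f by (simp add: linear_form_diff)
qed

lemma teq3_trilin_map:
  assumes "teq3 sc ts us" "trilin_map P"
  shows "(\<Sum>p\<leftarrow>ts. P (fst p) (fst (snd p)) (snd (snd p))) =
         (\<Sum>p\<leftarrow>us. P (fst p) (fst (snd p)) (snd (snd p)))" (is "?l = ?r")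
proof (rule ccontr)
  assume "?l \<noteq> ?r"
  then obtain f where f: "linear_form f" "f (?l - ?r) \<noteq> 0"
    using linear_form_separates[of "?l - ?r"] by auto
  have "trilin sc (\<lambda>s t u. f (P s t u))"
    using f(1) assms(2) unfolding trilin_def linear_form_def trilin_map_def by simp
  hence "f ?l = f ?r"
    using assms(1) unfolding teq3_def linear_form_sum_list[OF f(1)] by blast
  thus False
    using f by (simp add: linear_form_diff)
qed

end

locale hopf = f_alg sc
  for sc :: "'f::field \<Rightarrow> 'a::ring_1 \<Rightarrow> 'a" +
  fixes D :: "'a \<Rightarrow> ('a \<times> 'a) list" and e :: "'a \<Rightarrow> 'f" and S :: "'a \<Rightarrow> 'a"
  assumes hopf_alg: "hopf_alg sc D e S"
begin

lemma
  shows e_add [simp]: "e (a + b) = e a + e b"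
    and e_scale [simp]: "e (sc k a) = k * e a"
    and e_one [simp]: "e 1 = 1"
    and e_mult [simp]: "e (a * b) = e a * e b"
    and S_add [simp]: "S (a + b) = S a + S b"
    and S_scale [simp]: "S (sc k a) = sc k (S a)"
  using hopf_alg unfolding hopf_alg_def by simp_all

lemma linear_form_e: "linear_form e"
  by (simp add: linear_form_def)

lemma e_0 [simp]: "e 0 = 0"
  by (rule linear_form_0[OF linear_form_e])

lemma S_0 [simp]: "S 0 = 0"
  using S_scale[of 0 0] by simp

text \<open>The value of the linear map induced by \<open>B\<close> on the tensor \<open>\<Delta> z\<close>.\<close>

definition dsum :: "('a \<Rightarrow> 'a \<Rightarrow> 'a) \<Rightarrow> 'a \<Rightarrow> 'a" where
  "dsum B z = (\<Sum>p\<leftarrow>D z. B (fst p) (snd p))"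

lemma dsum_teq:
  "teq sc (D z) ts \<Longrightarrow> bilin_map B \<Longrightarrow> dsum B z = (\<Sum>p\<leftarrow>ts. B (fst p) (snd p))"
  unfolding dsum_def by (rule teq_bilin_map)

lemma dsum_add: "bilin_map B \<Longrightarrow> dsum B (y + z) = dsum B y + dsum B z"
  using dsum_teq[of "y + z" "D y @ D z" B] hopf_alg
  by (simp add: hopf_alg_def dsum_def)

lemma dsum_scale:
  assumes "bilin_map B"
  shows "dsum B (sc k z) = sc k (dsum B z)"
proof -
  have "(\<Sum>p\<leftarrow>tscale sc k ts. B (fst p) (snd p)) = sc k (\<Sum>p\<leftarrow>ts. B (fst p) (snd p))" for ts
    using assms by (induction ts) (simp_all add: tscale_def bilin_map_def scale_right_distrib)
  thus ?thesis
    using dsum_teq[of "sc k z" "tscale sc k (D z)" B] hopf_alg assms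
    by (simp add: hopf_alg_def dsum_def)
qed

lemma dsum_mult:
  assumes "bilin_map B"
  shows "dsum B (y * z) = dsum (\<lambda>s t. dsum (\<lambda>s' t'. B (s * s') (t * t')) z) y"
proof -
  have *: "(\<Sum>p\<leftarrow>tmul ts us. B (fst p) (snd p)) =
      (\<Sum>p\<leftarrow>ts. \<Sum>q\<leftarrow>us. B (fst p * fst q) (snd p * snd q))" for ts us
    by (induction ts) (simp_all add: tmul_def comp_def)
  show ?thesis
    using dsum_teq[of "y * z" "tmul (D y) (D z)" B] hopf_alg assms
    by (simp add: hopf_alg_def dsum_def *)
qed

lemma dsum_coassoc:
  assumes "trilin_map P"
  shows "dsum (\<lambda>s t. dsum (\<lambda>s' t'. P s' t' t) s) z = dsum (\<lambda>s t. dsum (\<lambda>s' t'. P s s' t') t) z"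
proof -
  have L: "(\<Sum>p\<leftarrow>coL D ts. P (fst p) (fst (snd p)) (snd (snd p))) =
      (\<Sum>p\<leftarrow>ts. \<Sum>q\<leftarrow>D (fst p). P (fst q) (snd q) (snd p))" for ts
    by (induction ts) (simp_all add: coL_def comp_def)
  have R: "(\<Sum>p\<leftarrow>coR D ts. P (fst p) (fst (snd p)) (snd (snd p))) =
      (\<Sum>p\<leftarrow>ts. \<Sum>q\<leftarrow>D (snd p). P (fst p) (fst q) (snd q))" for ts
    by (induction ts) (simp_all add: coR_def comp_def)
  show ?thesis
    using teq3_trilin_map[OF _ assms, of "coL D (D z)" "coR D (D z)"] hopf_alg
    by (simp add: hopf_alg_def dsum_def L R)
qed

lemma
  shows dsum_counit_left: "dsum (\<lambda>s t. sc (e s) t) z = z"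
    and dsum_counit_right: "dsum (\<lambda>s t. sc (e t) s) z = z"
    and dsum_antipode_left: "dsum (\<lambda>s t. S s * t) z = sc (e z) 1"
    and dsum_antipode_right: "dsum (\<lambda>s t. s * S t) z = sc (e z) 1"
  using hopf_alg by (simp_all add: hopf_alg_def dsum_def)

text \<open>A Sweedler sum is finite, so additivity of \<open>h\<close> is enough. This lets
  \<open>S\<close>, \<open>tau\<close> and one-sided multiplications pass through such sums.\<close>

lemma dsum_additive:
  assumes "\<And>a b. h (a + b) = h a + h b"
  shows "h (dsum B z) = dsum (\<lambda>s t. h (B s t)) (z :: 'a)"
proof -
  have "h 0 = (0 :: 'a)"
    using assms[of 0 0] by simp
  hence "h (\<Sum>p\<leftarrow>ts. B (fst p) (snd p)) = (\<Sum>p\<leftarrow>ts. h (B (fst p) (snd p)))" for ts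
    by (induction ts) (simp_all add: assms)
  thus ?thesis
    by (simp add: dsum_def)
qed

lemma e_dsum: "e (dsum B z) = (\<Sum>p\<leftarrow>D z. e (B (fst p) (snd p)))"
  by (simp add: dsum_def linear_form_sum_list[OF linear_form_e])

lemma dsum_arg_add: "dsum (\<lambda>s t. B s t + C s t) z = dsum B z + dsum C z"
  by (simp add: dsum_def sum_list_addf)

lemma dsum_arg_scale: "dsum (\<lambda>s t. sc k (B s t)) z = sc k (dsum B z)"
  by (rule dsum_additive[symmetric]) (simp add: scale_right_distrib)

lemma dsum_mult_left: "dsum (\<lambda>s t. c * B s t) z = c * dsum B z"
  by (rule dsum_additive[symmetric]) (simp add: distrib_left)

lemma dsum_mult_right: "dsum (\<lambda>s t. B s t * c) z = dsum B z * c"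
  by (rule dsum_additive[symmetric, where h = "\<lambda>u. u * c"]) (simp add: distrib_right)

lemma dsum_arg_0 [simp]: "dsum (\<lambda>s t. 0) z = 0"
  by (simp add: dsum_def)

text \<open>In an iterated Sweedler sum the outer summand must itself be bilinear before the outer
  coproduct can be replaced by an explicit tensor such as that of \<open>x\<close>.\<close>

lemma bilin_map_dsum_left:
  assumes "trilin_map P"
  shows "bilin_map (\<lambda>s t. dsum (\<lambda>s' t'. P s' t' t) s)"
proof -
  have "bilin_map (\<lambda>s' t'. P s' t' t)" for t
    using assms by (simp add: trilin_map_def bilin_map_def)
  thus ?thesis
    using assms by (simp add: bilin_map_def[of "\<lambda>s t. dsum (\<lambda>s' t'. P s' t' t) s"]
        dsum_add dsum_scale trilin_map_def dsum_arg_add dsum_arg_scale)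
qed

lemma bilin_map_dsum_right:
  assumes "trilin_map P"
  shows "bilin_map (\<lambda>s t. dsum (\<lambda>s' t'. P s s' t') t)"
proof -
  have "bilin_map (\<lambda>s' t'. P s s' t')" for s
    using assms by (simp add: trilin_map_def bilin_map_def)
  thus ?thesis
    using assms by (simp add: bilin_map_def[of "\<lambda>s t. dsum (\<lambda>s' t'. P s s' t') t"]
        dsum_add dsum_scale trilin_map_def dsum_arg_add dsum_arg_scale)
qed

text \<open>Apply \<open>e\<close> to S(z_1) z_2 = e(z) 1 and absorb e(z_2) into the argument of
  \<open>S\<close>.\<close>

lemma e_S [simp]: "e (S z) = e z"
proof -
  have "e z = e (dsum (\<lambda>s t. S s * t) z)"
    by (simp add: dsum_antipode_left)
  also have "\<dots> = e (dsum (\<lambda>s t. S (sc (e t) s)) z)"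
    by (simp add: e_dsum mult.commute)
  also have "dsum (\<lambda>s t. S (sc (e t) s)) z = S (dsum (\<lambda>s t. sc (e t) s) z)"
    by (rule dsum_additive[symmetric]) simp
  finally show ?thesis
    by (simp add: dsum_counit_right)
qed

text \<open>Both sides are convolution inverses of the multiplication map \<open>T \<otimes> T \<rightarrow> T\<close>.\<close>

lemma S_mult: "S (y * z) = S z * S y"
proof -
  \<comment> \<open>In Sweedler notation \<open>?E\<close> is the sum of S(y_1 z_1) y_2 z_2 S(z_3)
    S(y_3). Contracting S(y_1 z_1) y_2 z_2 leaves \<open>S z * S y\<close>; contracting z_2 S(z_3)
    and then y_2 S(y_3) leaves \<open>S (y * z)\<close>.\<close>
  let ?E = "dsum (\<lambda>s t. dsum (\<lambda>s' t'. dsum (\<lambda>u v. dsum (\<lambda>u' v'.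
      S (u * u') * (v * v') * (S t' * S t)) s') s) z) y"
  have bl: "bilin_map (\<lambda>s t. S s * t)"
    by (simp add: bilin_map_def algebra_simps)
  have "dsum (\<lambda>u v. dsum (\<lambda>u' v'. S (u * u') * (v * v') * (S t' * S t)) s') s
      = sc (e s * e s') (S t' * S t)" for s t s' t'
    using dsum_mult[OF bl, of s s', symmetric] by (simp add: dsum_mult_right dsum_antipode_left)
  hence "?E = dsum (\<lambda>s t. dsum (\<lambda>s' t'. sc (e s * e s') (S t' * S t)) z) y"
    by simp
  also have "\<dots> = dsum (\<lambda>s t. sc (e s) (S z * S t)) y"
  proof -
    have "dsum (\<lambda>s' t'. sc (e s * e s') (S t' * S t)) z = sc (e s) (S z * S t)" for s t
    proof -
      have "dsum (\<lambda>s' t'. sc (e s * e s') (S t' * S t)) z =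
          dsum (\<lambda>s' t'. sc (e s) (S (sc (e s') t') * S t)) z"
        by simp
      also have "\<dots> = sc (e s) (dsum (\<lambda>s' t'. S (sc (e s') t')) z * S t)"
        unfolding dsum_arg_scale dsum_mult_right ..
      also have "dsum (\<lambda>s' t'. S (sc (e s') t')) z = S z"
        using dsum_additive[of S "\<lambda>s' t'. sc (e s') t'" z, symmetric]
        by (simp only: S_add dsum_counit_left)
      finally show ?thesis .
    qed
    thus ?thesis by simp
  qed
  also have "\<dots> = dsum (\<lambda>s t. S z * S (sc (e s) t)) y"
    by simp
  also have "\<dots> = S z * S y"
    unfolding dsum_mult_left
    using dsum_additive[of S "\<lambda>s' t'. sc (e s') t'" y, symmetric]
    by (simp only: S_add dsum_counit_left)
  finally have 1: "?E = S z * S y" .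

  \<comment> \<open>The sums over \<Delta>(y) and \<Delta>(z) are independent, so either one can be
    moved inside to be contracted first.\<close>
  have swap: "dsum (\<lambda>s t. dsum (\<lambda>s' t'. F s t s' t') z') y' = dsum (\<lambda>s' t'. dsum (\<lambda>s t. F s t s' t') y') z'"
    for F y' z'
  proof -
    have "(\<Sum>p\<leftarrow>ts. \<Sum>q\<leftarrow>us. F (fst p) (snd p) (fst q) (snd q)) =
          (\<Sum>q\<leftarrow>us. \<Sum>p\<leftarrow>ts. F (fst p) (snd p) (fst q) (snd q))" for ts us
      by (induction ts) (simp_all add: sum_list_addf)
    thus ?thesis
      by (simp add: dsum_def)
  qed
  have "?E = dsum (\<lambda>s t. dsum (\<lambda>u v. dsum (\<lambda>s' t'. dsum (\<lambda>u' v'.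
      S (u * u') * (v * v') * (S t' * S t)) s') z) s) y"
    by (subst swap) simp
  also have "\<dots> = dsum (\<lambda>s t. dsum (\<lambda>u v. dsum (\<lambda>s' t'. dsum (\<lambda>u' v'.
      S (u * s') * (v * u') * (S v' * S t)) t') z) s) y"
  proof -
    have "trilin_map (\<lambda>u' v' t'. S (u * u') * (v * v') * (S t' * S t))" for u v t
      by (simp add: trilin_map_def algebra_simps)
    thus ?thesis
      by (simp add: dsum_coassoc)
  qed
  also have "\<dots> = dsum (\<lambda>s t. dsum (\<lambda>u v. dsum (\<lambda>s' t'. sc (e t') (S (u * s') * v * S t)) z) s) y"
  proof -
    have "dsum (\<lambda>u' v'. S (u * s') * (v * u') * (S v' * S t)) t' =
        dsum (\<lambda>u' v'. (S (u * s') * v) * ((u' * S v') * S t)) t'" for u v s' t' t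
      by (simp add: mult.assoc)
    thus ?thesis
      unfolding dsum_mult_left dsum_mult_right by (simp add: dsum_antipode_right mult.assoc)
  qed
  also have "\<dots> = dsum (\<lambda>s t. dsum (\<lambda>u v. S (u * z) * v * S t) s) y"
  proof -
    have "dsum (\<lambda>s' t'. sc (e t') (S (u * s') * v * S t)) z = S (u * z) * v * S t" for u v t
    proof -
      have "dsum (\<lambda>s' t'. sc (e t') (S (u * s') * v * S t)) z
          = dsum (\<lambda>s' t'. S (u * sc (e t') s') * v * S t) z"
        by simp
      also have "\<dots> = dsum (\<lambda>s' t'. S (u * sc (e t') s')) z * v * S t"
        unfolding dsum_mult_right ..
      also have "dsum (\<lambda>s' t'. S (u * sc (e t') s')) z = S (u * z)"
        using dsum_additive[of "\<lambda>s. S (u * s)" "\<lambda>s' t'. sc (e t') s'" z, symmetric]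
        by (simp only: S_add distrib_left dsum_counit_right)
      finally show ?thesis .
    qed
    thus ?thesis by simp
  qed
  also have "\<dots> = dsum (\<lambda>s t. dsum (\<lambda>u v. S (s * z) * (u * S v)) t) y"
  proof -
    have "trilin_map (\<lambda>u v t. S (u * z) * v * S t)"
      by (simp add: trilin_map_def algebra_simps)
    thus ?thesis
      by (simp add: dsum_coassoc mult.assoc)
  qed
  also have "\<dots> = dsum (\<lambda>s t. S (sc (e t) s * z)) y"
    unfolding dsum_mult_left by (simp add: dsum_antipode_right)
  also have "\<dots> = S (y * z)"
    using dsum_additive[of "\<lambda>s. S (s * z)" "\<lambda>s' t'. sc (e t') s'" y, symmetric]
    by (simp only: S_add distrib_right dsum_counit_right)
  finally show ?thesis
    using 1 by simp
qed

end

section \<open>Growth of algebras\<close>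

text \<open>The factor k n + 1 contributes the limit 1 of ln(k n + 1) / ln n. Rescaling n to M n is
  harmless because ln(M n) / ln n tends to 1 and the limsup along a subsequence is at most the full
  limsup.\<close>

lemma limsup_log_upper:
  fixes f h :: "nat \<Rightarrow> nat"
  assumes "\<And>n. h n \<le> (k * n + 1) * f (M * n)" "\<And>n. f n \<ge> 1" "\<And>n. h n \<ge> 1" "k \<ge> 1" "M \<ge> 1"
  shows "limsup (\<lambda>n. ereal (ln (real (h n)) / ln (real n))) \<le>
    limsup (\<lambda>n. ereal (ln (real (f n)) / ln (real n))) + 1"
proof -
  let ?F = "\<lambda>n. ereal (ln (real (f n)) / ln (real n))"
  have k: "real k > 0" and M: "real M > 0"
    using assms by auto
  have l1: "(\<lambda>n. ln (real (M * n)) / ln (real n)) \<longlonglongrightarrow> 1"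
    using M unfolding of_nat_mult by real_asymp
  have l2: "(\<lambda>n. ln (real (k * n + 1)) / ln (real n)) \<longlonglongrightarrow> 1"
    using k unfolding of_nat_mult of_nat_add by real_asymp
  have "limsup (\<lambda>n. ereal (ln (real (h n)) / ln (real n))) \<le>
      limsup (\<lambda>n. ereal (ln (real (k * n + 1)) / ln (real n)) +
        ereal (ln (real (M * n)) / ln (real n)) * ?F (M * n))"
  \<comment> \<open>From n = 2 on the logarithms in the denominators are positive.\<close>
  proof (rule Limsup_mono, rule eventually_sequentiallyI[of 2])
    fix n :: nat assume n: "2 \<le> n"
    have "M * n \<ge> 2"
      using n assms(5) by (metis mult_le_mono mult_1 le_trans)
    hence pos: "ln (real n) > 0" "ln (real (M * n)) > 0"
      using n by (auto simp: ln_gt_zero simp del: of_nat_mult)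
    have "real (h n) \<le> real ((k * n + 1) * f (M * n))"
      using assms(1) of_nat_mono by blast
    hence "ln (real (h n)) \<le> ln (real ((k * n + 1) * f (M * n)))"
      using assms(3)[of n] by (subst ln_le_cancel_iff) auto
    also have "\<dots> = ln (real (k * n + 1)) + ln (real (f (M * n)))"
      using assms(2)[of "M * n"] unfolding of_nat_mult[of "k * n + 1"] by (subst ln_mult) (auto simp: add_nonneg_eq_0_iff)
    finally have "ln (real (h n)) / ln (real n) \<le>
        ln (real (k * n + 1)) / ln (real n) + ln (real (f (M * n))) / ln (real n)"
      using pos by (simp add: divide_simps)
    also have "ln (real (f (M * n))) / ln (real n) =
        ln (real (M * n)) / ln (real n) * (ln (real (f (M * n))) / ln (real (M * n)))"
      using pos by simp
    finally show "ereal (ln (real (h n)) / ln (real n)) \<le> ereal (ln (real (k * n + 1)) / ln (real n)) +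
        ereal (ln (real (M * n)) / ln (real n)) * ?F (M * n)"
      by simp
  qed
  also have "\<dots> = 1 + limsup (\<lambda>n. ereal (ln (real (M * n)) / ln (real n)) * ?F (M * n))"
    by (rule ereal_limsup_lim_add) (use l2 in \<open>simp_all add: one_ereal_def\<close>)
  also have "limsup (\<lambda>n. ereal (ln (real (M * n)) / ln (real n)) * ?F (M * n)) =
      1 * limsup (\<lambda>n. ?F (M * n))"
    by (rule ereal_limsup_lim_mult) (use l1 in \<open>simp_all add: one_ereal_def\<close>)
  also have "1 + 1 * limsup (\<lambda>n. ?F (M * n)) \<le> 1 + limsup ?F"
    using limsup_subseq_mono[of "\<lambda>n. M * n" ?F] assms(5)
    by (intro add_left_mono) (simp add: strict_mono_def comp_def)
  finally show ?thesis
    by (simp add: add.commute)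
qed

text \<open>Dual to the upper estimate: everything is divided by ln(2 n), and the values of
  \<open>h\<close> at even arguments form a subsequence.\<close>

lemma limsup_log_lower:
  fixes f h :: "nat \<Rightarrow> nat"
  assumes "\<And>n. (n + 1) * f n \<le> h (2 * n)" "\<And>n. f n \<ge> 1"
  shows "limsup (\<lambda>n. ereal (ln (real (f n)) / ln (real n))) + 1 \<le>
    limsup (\<lambda>n. ereal (ln (real (h n)) / ln (real n)))"
proof -
  let ?F = "\<lambda>n. ereal (ln (real (f n)) / ln (real n))"
  let ?H = "\<lambda>n. ereal (ln (real (h n)) / ln (real n))"
  have l1: "(\<lambda>n. ln (real n) / ln (real (2 * n))) \<longlonglongrightarrow> 1"
    unfolding of_nat_mult by real_asymp
  have l2: "(\<lambda>n. ln (real (n + 1)) / ln (real (2 * n))) \<longlonglongrightarrow> 1"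
    unfolding of_nat_mult of_nat_add by real_asymp
  have "limsup ?F + 1 = 1 + 1 * limsup ?F"
    by (simp add: add.commute)
  also have "1 * limsup ?F = limsup (\<lambda>n. ereal (ln (real n) / ln (real (2 * n))) * ?F n)"
    by (rule ereal_limsup_lim_mult[symmetric]) (use l1 in \<open>simp_all add: one_ereal_def\<close>)
  also have "1 + \<dots> = limsup (\<lambda>n. ereal (ln (real (n + 1)) / ln (real (2 * n))) +
      ereal (ln (real n) / ln (real (2 * n))) * ?F n)"
    by (rule ereal_limsup_lim_add[symmetric]) (use l2 in \<open>simp_all add: one_ereal_def\<close>)
  also have "\<dots> \<le> limsup (\<lambda>n. ?H (2 * n))"
  proof (rule Limsup_mono, rule eventually_sequentiallyI[of 2])
    fix n :: nat assume n: "2 \<le> n"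
    hence pos: "ln (real n) > 0" "ln (real (2 * n)) > 0"
      by (auto simp: ln_gt_zero)
    have "ln (real (n + 1)) + ln (real (f n)) = ln (real ((n + 1) * f n))"
      using assms(2)[of n] unfolding of_nat_mult by (subst ln_mult) (auto simp: add_nonneg_eq_0_iff)
    also have "real ((n + 1) * f n) \<le> real (h (2 * n))"
      using assms(1) of_nat_mono by blast
    hence "ln (real ((n + 1) * f n)) \<le> ln (real (h (2 * n)))"
      using assms(2)[of n] by (subst ln_le_cancel_iff) (auto simp del: of_nat_mult)
    finally have "ln (real (n + 1)) / ln (real (2 * n)) + ln (real (f n)) / ln (real (2 * n)) \<le>
        ln (real (h (2 * n))) / ln (real (2 * n))"
      using pos by (simp add: divide_simps)
    also have "ln (real (f n)) / ln (real (2 * n)) =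
        ln (real n) / ln (real (2 * n)) * (ln (real (f n)) / ln (real n))"
      using pos by simp
    finally show "ereal (ln (real (n + 1)) / ln (real (2 * n))) +
      ereal (ln (real n) / ln (real (2 * n))) * ?F n \<le> ?H (2 * n)"
      by simp
  qed
  also have "\<dots> \<le> limsup ?H"
    using limsup_subseq_mono[of "\<lambda>n. 2 * n" ?H] by (simp add: strict_mono_def comp_def)
  finally show ?thesis .
qed

section \<open>Powers of a generating space and their dimensions\<close>

context f_alg
begin

lemma subspace_mult_left: "subspace E \<Longrightarrow> subspace {t. c * t \<in> E}"
  by (auto simp: subspace_def distrib_left)

lemma subspace_mult_right: "subspace E \<Longrightarrow> subspace {t. t * c \<in> E}"
  by (auto simp: subspace_def distrib_right)

lemma span_mult_in:
  assumes "subspace E" "\<And>s t. s \<in> X \<Longrightarrow> t \<in> Y \<Longrightarrow> s * t \<in> E" "s \<in> span X" "t \<in> span Y"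
  shows "s * t \<in> E"
proof -
  have "t' \<in> span Y \<Longrightarrow> s' \<in> X \<Longrightarrow> s' * t' \<in> E" for s' t'
    using span_minimal[OF _ subspace_mult_left[OF assms(1), of s'], of Y] assms(2) by blast
  thus ?thesis
    using span_minimal[OF _ subspace_mult_right[OF assms(1), of t], of X] assms(3,4) by blast
qed

lemma subspace_powsp [simp]: "subspace (powsp sc B n)"
  by (simp add: powsp_def)

lemma powsp_prod_list: "powsp sc B n = span {prod_list xs | xs. length xs = n \<and> set xs \<subseteq> B}"
  by (simp add: powsp_def prod_list.eq_foldr)

lemma powsp_prod_listI: "length xs = n \<Longrightarrow> set xs \<subseteq> B \<Longrightarrow> prod_list xs \<in> powsp sc B n"
  unfolding powsp_prod_list by (rule span_base) blast

lemma powsp_mult: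
  assumes "s \<in> powsp sc B m" "t \<in> powsp sc B n"
  shows "s * t \<in> powsp sc B (m + n)"
  using subspace_powsp _ assms[unfolded powsp_prod_list]
proof (rule span_mult_in)
  fix s t assume "s \<in> {prod_list xs |xs. length xs = m \<and> set xs \<subseteq> B}"
    "t \<in> {prod_list xs |xs. length xs = n \<and> set xs \<subseteq> B}"
  then obtain xs ys where "s = prod_list xs" "length xs = m" "set xs \<subseteq> B"
    "t = prod_list ys" "length ys = n" "set ys \<subseteq> B"
    by blast
  thus "s * t \<in> powsp sc B (m + n)"
    using powsp_prod_listI[of "xs @ ys" "m + n" B] by simp
qed

lemma powsp_base: "s \<in> B \<Longrightarrow> s \<in> powsp sc B 1"
  using powsp_prod_listI[of "[s]" 1 B] by simp

text \<open>Words are built by prepending letters, so left multiplication by \<open>B\<close> is all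
  that has to be controlled. This serves as the induction principle for every filtration
  below.\<close>

lemma powsp_subsetI:
  assumes "\<And>n. subspace (E n)" "1 \<in> E 0" "\<And>n c t. c \<in> B \<Longrightarrow> t \<in> E n \<Longrightarrow> c * t \<in> E (Suc n)"
  shows "powsp sc B n \<subseteq> E n"
proof -
  have "set xs \<subseteq> B \<Longrightarrow> prod_list xs \<in> E (length xs)" for xs
    by (induction xs) (use assms in auto)
  thus ?thesis
    unfolding powsp_prod_list by (intro span_minimal assms) auto
qed

lemma one_in_powsp: "1 \<in> B \<Longrightarrow> 1 \<in> powsp sc B n"
  using powsp_prod_listI[of "replicate n 1" n B] by (auto simp: prod_list_replicate set_replicate_conv_if)

lemma powsp_mono: "B \<subseteq> C \<Longrightarrow> powsp sc B n \<subseteq> powsp sc C n"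
  unfolding powsp_prod_list by (rule span_mono) blast

lemma powsp_mono_exp: "1 \<in> B \<Longrightarrow> m \<le> n \<Longrightarrow> powsp sc B m \<subseteq> powsp sc B n"
  using powsp_mult[of _ B m 1 "n - m"] one_in_powsp[of B "n - m"] by fastforce

lemma powsp_pow: "s \<in> B \<Longrightarrow> 1 \<in> B \<Longrightarrow> i \<le> n \<Longrightarrow> s ^ i \<in> powsp sc B n"
  using powsp_prod_listI[of "replicate i s @ replicate (n - i) 1" n B]
  by (auto simp: prod_list_replicate set_replicate_conv_if)

lemma powsp_compose:
  assumes "B \<subseteq> powsp sc C k"
  shows "powsp sc B n \<subseteq> powsp sc C (k * n)"
proof (rule powsp_subsetI)
  show "1 \<in> powsp sc C (k * 0)"
    using powsp_prod_listI[of "[]" 0 C] by simp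
  fix n c t assume "c \<in> B" "t \<in> powsp sc C (k * n)"
  thus "c * t \<in> powsp sc C (k * Suc n)"
    using powsp_mult[of c C k t "k * n"] assms by auto
qed simp

lemma powsp_span: "powsp sc (span B) n = powsp sc B n"
proof
  have "span B \<subseteq> powsp sc B 1"
    by (rule span_minimal) (use powsp_base in auto)
  thus "powsp sc (span B) n \<subseteq> powsp sc B n"
    using powsp_compose[of "span B" B 1 n] by simp
qed (rule powsp_mono[OF span_superset])

text \<open>There are only finitely many words of length \<open>n\<close> over a finite set.
  Finiteness matters because an infinite basis has \<open>card\<close> 0, which would make
  \<open>dim\<close> useless for comparisons.\<close>

lemma powsp_basis:
  assumes "finite B"
  obtains C where "finite C" "C \<subseteq> powsp sc B n" "independent C" "span C = powsp sc B n"
    "card C = dim (powsp sc B n)"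
proof -
  obtain C where C: "C \<subseteq> powsp sc B n" "independent C" "powsp sc B n \<subseteq> span C"
    "card C = dim (powsp sc B n)"
    using basis_exists[of "powsp sc B n"] by metis
  have "{prod_list xs | xs. length xs = n \<and> set xs \<subseteq> B} = prod_list ` {xs. set xs \<subseteq> B \<and> length xs = n}"
    by auto
  hence "finite {prod_list xs | xs. length xs = n \<and> set xs \<subseteq> B}"
    using finite_lists_length_eq[OF assms] by simp
  hence "finite C"
    using independent_span_bound C(1,2) unfolding powsp_prod_list by blast
  moreover have "span C = powsp sc B n"
    using C span_minimal[OF C(1)] by (auto simp: powsp_def)
  ultimately show ?thesis
    using that C by blast
qed

lemma independent_card_le_dim_powsp:
  assumes "finite B" "independent X" "X \<subseteq> powsp sc B n"
  shows "card X \<le> dim (powsp sc B n)"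
proof -
  obtain C where "finite C" "span C = powsp sc B n" "card C = dim (powsp sc B n)"
    using powsp_basis[OF assms(1)] by metis
  thus ?thesis
    using independent_span_bound[of C X] assms by simp
qed

lemma dim_powsp_pos:
  assumes "finite B" "1 \<in> B"
  shows "dim (powsp sc B n) \<ge> 1"
  using independent_card_le_dim_powsp[OF assms(1), of "{1}"] one_in_powsp[OF assms(2)] by simp

text \<open>Products of a basis of the \<open>N\<close>-th power with \<open>z ^ i\<close>, i \<le>
  n, span the space on the right; counting them gives the bound.\<close>

lemma dim_mult_powers_le:
  assumes "finite B" "X \<subseteq> span {r * z ^ i | r i. r \<in> powsp sc B N \<and> i \<le> n}"
  shows "dim X \<le> (n + 1) * dim (powsp sc B N)"
proof -
  obtain C where C: "finite C" "span C = powsp sc B N" "card C = dim (powsp sc B N)"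
    using powsp_basis[OF assms(1)] by metis
  let ?Y = "(\<lambda>(c, i). c * z ^ i) ` (C \<times> {..n})"
  have "r * z ^ i \<in> span ?Y" if "r \<in> powsp sc B N" "i \<le> n" for r i
  proof -
    have "C \<subseteq> {t. t * z ^ i \<in> span ?Y}"
      using that by (force intro: span_base)
    hence "span C \<subseteq> {t. t * z ^ i \<in> span ?Y}"
      by (rule span_minimal) (rule subspace_mult_right, simp)
    thus ?thesis
      using that C by blast
  qed
  hence "span {r * z ^ i | r i. r \<in> powsp sc B N \<and> i \<le> n} \<subseteq> span ?Y"
    by (intro span_minimal) auto
  hence "dim X \<le> card ?Y"
    using assms(2) C(1) by (intro dim_le_card) auto
  also have "\<dots> \<le> card (C \<times> {..n})"
    using C(1) by (intro card_image_le) auto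
  finally show ?thesis
    using C(3) by (simp add: card_cartesian_product mult.commute)
qed

text \<open>Independence of the indexed family also excludes repetitions, so the image has as many
  elements as the index set and can be used to count dimensions.\<close>

lemma inj_independent_imageI:
  assumes "finite I" "\<And>u i. (\<Sum>j\<in>I. sc (u j) (g j)) = 0 \<Longrightarrow> i \<in> I \<Longrightarrow> u i = 0"
  shows "inj_on g I" "independent (g ` I)"
proof -
  show inj: "inj_on g I"
  proof (rule inj_onI, rule ccontr)
    fix i j assume ij: "i \<in> I" "j \<in> I" "g i = g j" "i \<noteq> j"
    \<comment> \<open>A repeated value would give the nontrivial relation
      \<open>g i - g j = 0\<close>.\<close>
    let ?u = "\<lambda>k. if k = i then 1 else if k = j then - 1 else 0"
    have "(\<Sum>k\<in>I. sc (?u k) (g k)) = (\<Sum>k\<in>{i, j}. sc (?u k) (g k))"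
      by (rule sum.mono_neutral_right) (use ij assms(1) in auto)
    also have "\<dots> = 0"
      using ij by simp
    finally show False
      using assms(2)[of ?u i] ij by simp
  qed
  show "independent (g ` I)"
  proof (rule independent_if_scalars_zero)
    fix u t assume "(\<Sum>t\<in>g ` I. sc (u t) t) = 0" "t \<in> g ` I"
    thus "u t = 0"
      using assms(2)[of "u \<circ> g"] by (auto simp: sum.reindex[OF inj])
  qed (use assms(1) in simp)
qed

lemma subalg_Union_powsp:
  assumes "1 \<in> B"
  shows "subalg sc (\<Union>n. powsp sc B n)"
  unfolding subalg_def
proof (intro conjI ballI allI)
  show "0 \<in> (\<Union>n. powsp sc B n)"
    using subspace_0[OF subspace_powsp] by blast
  show "1 \<in> (\<Union>n. powsp sc B n)"
    using one_in_powsp[OF assms] by blast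
  fix s t assume "s \<in> (\<Union>n. powsp sc B n)" "t \<in> (\<Union>n. powsp sc B n)"
  then obtain m n where mn: "s \<in> powsp sc B m" "t \<in> powsp sc B n"
    by blast
  hence "s \<in> powsp sc B (max m n)" "t \<in> powsp sc B (max m n)"
    using powsp_mono_exp[OF assms] by (meson max.cobounded1 max.cobounded2 subsetD)+
  hence "s + t \<in> powsp sc B (max m n)"
    using subspace_add[OF subspace_powsp] by blast
  thus "s + t \<in> (\<Union>n. powsp sc B n)"
    by blast
  show "s * t \<in> (\<Union>n. powsp sc B n)"
    using powsp_mult[OF mn] by blast
next
  fix k s assume "s \<in> (\<Union>n. powsp sc B n)"
  thus "sc k s \<in> (\<Union>n. powsp sc B n)"
    using subspace_scale[OF subspace_powsp] by blast
qed

text \<open>Since 1 lies in \<open>B\<close> the powers increase, so finitely many exponents have a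
  common bound. The bound n \<ge> 1 keeps the later rescaling factor positive.\<close>

lemma finite_subset_powsp:
  assumes "1 \<in> B" "finite X" "X \<subseteq> (\<Union>n. powsp sc B n)"
  shows "\<exists>n\<ge>1. X \<subseteq> powsp sc B n"
  using assms(2,3)
proof (induction X)
  case (insert t X)
  then obtain m n where "t \<in> powsp sc B m" "X \<subseteq> powsp sc B n" "n \<ge> 1"
    by blast
  hence "insert t X \<subseteq> powsp sc B (max m n)" "max m n \<ge> 1"
    using powsp_mono_exp[OF assms(1), of m "max m n"] powsp_mono_exp[OF assms(1), of n "max m n"]
    by auto
  thus ?case
    by blast
qed auto

end

section \<open>Hopf Ore extensions\<close>

locale hopf_ore = hopf sc D e S
  for sc :: "'f::field \<Rightarrow> 'a::ring_1 \<Rightarrow> 'a"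
    and D :: "'a \<Rightarrow> ('a \<times> 'a) list" and e :: "'a \<Rightarrow> 'f" and S :: "'a \<Rightarrow> 'a" +
  fixes R :: "'a set" and \<sigma> \<delta> :: "'a \<Rightarrow> 'a" and x \<alpha> \<alpha>' \<beta> a b :: 'a and v w :: "('a \<times> 'a) list"
  assumes hopf_subalg: "hopf_subalg sc D S R"
    and aut: "alg_aut_on sc R \<sigma>"
    and deriv: "sigma_deriv_on sc R \<sigma> \<delta>"
    and ore: "ore_ext R \<sigma> \<delta> x"
    and abR [simp]: "a \<in> R" "b \<in> R"
    and vR: "set v \<subseteq> R \<times> R" and wR: "set w \<subseteq> R \<times> R"
    and D_x: "teq sc (D x) ([(a, x), (x, b)] @ map (\<lambda>p. (fst p * x, snd p * x)) v @ w)"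
    and alphaR [simp]: "\<alpha> \<in> R" "\<beta> \<in> R" "\<alpha>' \<in> R"
    and alpha_inv: "\<alpha> * \<alpha>' = 1" "\<alpha>' * \<alpha> = 1"
    and S_x: "S x = \<alpha> * x + \<beta>"
begin

section \<open>Closure properties of R and rules for the twisting data\<close>

lemma
  shows R_0 [simp]: "0 \<in> R" and R_1 [simp]: "1 \<in> R"
    and R_add [simp]: "r \<in> R \<Longrightarrow> s \<in> R \<Longrightarrow> r + s \<in> R"
    and R_mult [simp]: "r \<in> R \<Longrightarrow> s \<in> R \<Longrightarrow> r * s \<in> R"
    and R_scale [simp]: "r \<in> R \<Longrightarrow> sc k r \<in> R"
    and R_S [simp]: "r \<in> R \<Longrightarrow> S r \<in> R"
  using hopf_subalg by (auto simp: hopf_subalg_def subalg_def bij_betw_def)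

lemma R_uminus [simp]: "r \<in> R \<Longrightarrow> - r \<in> R"
  using R_scale[of r "-1"] by simp

lemma R_diff [simp]: "r \<in> R \<Longrightarrow> s \<in> R \<Longrightarrow> r - s \<in> R"
  using R_add[of r "- s"] by simp

lemma R_sum: "(\<And>i. i \<in> I \<Longrightarrow> f i \<in> R) \<Longrightarrow> sum f I \<in> R"
  by (induction I rule: infinite_finite_induct) auto

lemma R_sum_list: "(\<And>p. p \<in> set ts \<Longrightarrow> f p \<in> R) \<Longrightarrow> (\<Sum>p\<leftarrow>ts. f p) \<in> R"
  by (induction ts) auto

lemma
  shows vR1 [simp]: "p \<in> set v \<Longrightarrow> fst p \<in> R" and vR2 [simp]: "p \<in> set v \<Longrightarrow> snd p \<in> R"
    and wR1 [simp]: "p \<in> set w \<Longrightarrow> fst p \<in> R" and wR2 [simp]: "p \<in> set w \<Longrightarrow> snd p \<in> R"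
  using vR wR by auto

lemma
  shows sigma_R [simp]: "r \<in> R \<Longrightarrow> \<sigma> r \<in> R"
    and sigma_1 [simp]: "\<sigma> 1 = 1"
    and sigma_add: "r \<in> R \<Longrightarrow> s \<in> R \<Longrightarrow> \<sigma> (r + s) = \<sigma> r + \<sigma> s"
    and sigma_mult: "r \<in> R \<Longrightarrow> s \<in> R \<Longrightarrow> \<sigma> (r * s) = \<sigma> r * \<sigma> s"
    and sigma_scale: "r \<in> R \<Longrightarrow> \<sigma> (sc k r) = sc k (\<sigma> r)"
    and sigma_inj: "inj_on \<sigma> R"
  using aut by (auto simp: alg_aut_on_def bij_betw_def)

lemma sigma_0 [simp]: "\<sigma> 0 = 0"
  using sigma_add[of 0 0] by simp

lemma
  shows delta_R [simp]: "r \<in> R \<Longrightarrow> \<delta> r \<in> R"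
    and delta_add: "r \<in> R \<Longrightarrow> s \<in> R \<Longrightarrow> \<delta> (r + s) = \<delta> r + \<delta> s"
    and delta_mult: "r \<in> R \<Longrightarrow> s \<in> R \<Longrightarrow> \<delta> (r * s) = \<sigma> r * \<delta> s + \<delta> r * s"
    and delta_scale: "r \<in> R \<Longrightarrow> \<delta> (sc k r) = sc k (\<delta> r)"
  using deriv by (auto simp: sigma_deriv_on_def)

section \<open>Coefficients of skew polynomials\<close>

lemma x_comm: "r \<in> R \<Longrightarrow> x * r = \<sigma> r * x + \<delta> r"
  using ore unfolding ore_ext_def by (metis diff_add_cancel add.commute)

lemma ore_indep: "(\<And>i. i < n \<Longrightarrow> c i \<in> R) \<Longrightarrow> (\<Sum>i<n. c i * x ^ i) = 0 \<Longrightarrow> i < n \<Longrightarrow> c i = 0"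
  using ore unfolding ore_ext_def by blast

text \<open>Freeness in degree at most 2, the highest degree that occurs in the antipode axiom at
  \<open>x\<close>.\<close>

lemma ore_quadratic:
  assumes "r0 \<in> R" "r1 \<in> R" "r2 \<in> R" "r0 + r1 * x + r2 * x\<^sup>2 = 0"
  shows "r0 = 0" "r1 = 0" "r2 = 0"
proof -
  let ?c = "\<lambda>i::nat. if i = 0 then r0 else if i = 1 then r1 else r2"
  have "?c i = 0" if "i < 3" for i
    by (rule ore_indep[of 3 ?c]) (use assms that in \<open>auto simp: eval_nat_numeral\<close>)
  from this[of 0] this[of 1] this[of 2] show "r0 = 0" "r1 = 0" "r2 = 0"
    by simp_all
qed

text \<open>Left coefficients padded by zeros, so that \<open>coef\<close> is linear on all of T and
  can be used inside bilinear test maps.\<close>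

definition is_coef :: "'a \<Rightarrow> (nat \<Rightarrow> 'a) \<Rightarrow> bool" where
  "is_coef t c \<longleftrightarrow> (\<forall>i. c i \<in> R) \<and> (\<exists>n. (\<forall>i\<ge>n. c i = 0) \<and> t = (\<Sum>i<n. c i * x ^ i))"

definition coef :: "'a \<Rightarrow> nat \<Rightarrow> 'a" where
  "coef t = (SOME c. is_coef t c)"

lemma is_coef_large:
  assumes "is_coef t c"
  obtains n where "\<And>m. m \<ge> n \<Longrightarrow> (\<forall>i\<ge>m. c i = 0) \<and> t = (\<Sum>i<m. c i * x ^ i)"
proof -
  obtain n where n: "\<forall>i\<ge>n. c i = 0" "t = (\<Sum>i<n. c i * x ^ i)"
    using assms by (auto simp: is_coef_def)
  have "(\<Sum>i<n. c i * x ^ i) = (\<Sum>i<m. c i * x ^ i)" if "m \<ge> n" for m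
    by (rule sum.mono_neutral_left) (use that n in auto)
  thus ?thesis
    using that[of n] n by simp
qed

lemma is_coef_add:
  assumes "is_coef t c" "is_coef u d"
  shows "is_coef (t + u) (\<lambda>i. c i + d i)"
proof -
  obtain n where n: "\<And>m. m \<ge> n \<Longrightarrow> (\<forall>i\<ge>m. c i = 0) \<and> t = (\<Sum>i<m. c i * x ^ i)"
    using is_coef_large[OF assms(1)] by blast
  obtain n' where n': "\<And>m. m \<ge> n' \<Longrightarrow> (\<forall>i\<ge>m. d i = 0) \<and> u = (\<Sum>i<m. d i * x ^ i)"
    using is_coef_large[OF assms(2)] by blast
  have "(\<forall>i\<ge>max n n'. c i + d i = 0) \<and> t + u = (\<Sum>i<max n n'. (c i + d i) * x ^ i)"
    using n[of "max n n'"] n'[of "max n n'"] by (simp add: distrib_right sum.distrib)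
  thus ?thesis
    using assms unfolding is_coef_def by (metis R_add)
qed

lemma is_coef_scale: "is_coef t c \<Longrightarrow> is_coef (sc k t) (\<lambda>i. sc k (c i))"
  unfolding is_coef_def by (fastforce simp: scale_sum_right)

lemma is_coef_unique:
  assumes "is_coef t c" "is_coef t d"
  shows "c = d"
proof
  fix j
  have "is_coef (sc (-1) t) (\<lambda>i. sc (-1) (d i))"
    using assms(2) by (rule is_coef_scale)
  hence "is_coef 0 (\<lambda>i. c i - d i)"
    using is_coef_add[OF assms(1)] by fastforce
  then obtain n where n: "\<And>m. m \<ge> n \<Longrightarrow> (\<forall>i\<ge>m. c i - d i = 0) \<and> 0 = (\<Sum>i<m. (c i - d i) * x ^ i)"
    by (rule is_coef_large) blast
  \<comment> \<open>The length \<open>max n (Suc j)\<close> reaches the index \<open>j\<close> even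
    when \<open>j\<close> lies beyond the support bound \<open>n\<close>.\<close>
  have "c j - d j = 0"
    using ore_indep[of "max n (Suc j)" "\<lambda>i. c i - d i" j] n[of "max n (Suc j)"] assms
    by (simp add: is_coef_def)
  thus "c j = d j"
    by simp
qed

lemma is_coef_exists: "\<exists>c. is_coef t c"
proof -
  obtain n c where c: "\<forall>i<n. c i \<in> R" "t = (\<Sum>i<n. c i * x ^ i)"
    using ore unfolding ore_ext_def by meson
  have "is_coef t (\<lambda>i. if i < n then c i else 0)"
    unfolding is_coef_def using c by (auto intro!: exI[of _ n] sum.cong)
  thus ?thesis
    by (rule exI[of "is_coef t"])
qed

lemma is_coef_coef: "is_coef t (coef t)"
  unfolding coef_def using is_coef_exists by (rule someI_ex)

lemma coef_eqI: "is_coef t c \<Longrightarrow> coef t = c"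
  using is_coef_coef is_coef_unique by blast

lemma coef_in_R [simp]: "coef t i \<in> R"
  using is_coef_coef[of t] by (simp add: is_coef_def)

lemma coef_add [simp]: "coef (t + u) i = coef t i + coef u i"
  using coef_eqI[OF is_coef_add[OF is_coef_coef is_coef_coef], of t u] by simp

lemma coef_scale [simp]: "coef (sc k t) i = sc k (coef t i)"
  using coef_eqI[OF is_coef_scale[OF is_coef_coef], of k t] by simp

lemma coef_R [simp]: "r \<in> R \<Longrightarrow> coef r i = (if i = 0 then r else 0)"
proof -
  assume "r \<in> R"
  hence "is_coef r (\<lambda>i. if i = 0 then r else 0)"
    unfolding is_coef_def by (auto intro!: exI[of _ 1])
  thus ?thesis
    by (simp add: coef_eqI)
qed

lemma coef_Rx [simp]: "r \<in> R \<Longrightarrow> coef (r * x) i = (if i = 1 then r else 0)"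
proof -
  assume "r \<in> R"
  hence "is_coef (r * x) (\<lambda>i. if i = 1 then r else 0)"
    unfolding is_coef_def by (auto intro!: exI[of _ 2] simp: eval_nat_numeral)
  thus ?thesis
    by (simp add: coef_eqI)
qed

lemma coef_x [simp]: "coef x i = (if i = 1 then 1 else 0)"
  using coef_Rx[of 1 i] by simp

text \<open>The list \<open>D r\<close> may have entries outside R; only some equivalent list has
  its entries in R. Hence \<open>B\<close> and \<open>C\<close> must be bilinear on all of T, while
  their agreement is tested on R only.\<close>

lemma dsum_cong_R:
  assumes "r \<in> R" "bilin_map B" "bilin_map C" "\<And>s t. s \<in> R \<Longrightarrow> t \<in> R \<Longrightarrow> B s t = C s t"
  shows "dsum B r = dsum C r"
proof -
  obtain ts where ts: "set ts \<subseteq> R \<times> R" "teq sc (D r) ts"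
    using hopf_subalg assms(1) unfolding hopf_subalg_def by blast
  have "map (\<lambda>p. B (fst p) (snd p)) ts = map (\<lambda>p. C (fst p) (snd p)) ts"
    using ts assms(4) by (auto simp: subset_iff)
  thus ?thesis
    using dsum_teq[OF ts(2)] assms by metis
qed

lemma bilin_map_0: "bilin_map (\<lambda>s t. 0)"
  by (simp add: bilin_map_def)

lemma dsum_R_0:
  assumes "r \<in> R" "bilin_map B" "\<And>s t. s \<in> R \<Longrightarrow> t \<in> R \<Longrightarrow> B s t = 0"
  shows "dsum B r = 0"
  using dsum_cong_R[OF assms(1,2) bilin_map_0] assms(3) by simp

lemma dsum_x:
  "bilin_map B \<Longrightarrow> dsum B x = B a x + B x b + (\<Sum>p\<leftarrow>v. B (fst p * x) (snd p * x)) +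
     (\<Sum>p\<leftarrow>w. B (fst p) (snd p))"
  using dsum_teq[OF D_x, of B] by (simp add: comp_def add.assoc)

lemma bilin_map_mult: "bilin_map B \<Longrightarrow> bilin_map (\<lambda>s' t'. B (s * s') (t * t'))"
  by (simp add: bilin_map_def algebra_simps)

lemma bilin_map_dsum_mult:
  assumes "bilin_map B"
  shows "bilin_map (\<lambda>s t. dsum (\<lambda>s' t'. B (s * s') (t * t')) z)"
  using assms by (simp add: bilin_map_def algebra_simps dsum_arg_add dsum_arg_scale)

text \<open>Since \<Delta>(r x) = \<Delta>(r) \<Delta>(x), the sum over \<open>r * x\<close> becomes
  one over \<open>r\<close>, whose legs may be taken in R. There the coefficients of all four kinds
  of terms are explicit.\<close>

lemma dsum_Rx_cong:
  assumes "r \<in> R" "bilin_map B" "bilin_map C"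
    and "\<And>s t. s \<in> R \<Longrightarrow> t \<in> R \<Longrightarrow>
      B (s * a) (t * x) + B (s * x) (t * b) + (\<Sum>p\<leftarrow>v. B (s * fst p * x) (t * snd p * x)) +
      (\<Sum>p\<leftarrow>w. B (s * fst p) (t * snd p)) = C s t"
  shows "dsum B (r * x) = dsum C r"
  unfolding dsum_mult[OF assms(2)]
  using assms(1) bilin_map_dsum_mult[OF assms(2)] assms(3)
proof (rule dsum_cong_R)
  fix s t assume "s \<in> R" "t \<in> R"
  thus "dsum (\<lambda>s' t'. B (s * s') (t * t')) x = C s t"
    unfolding dsum_x[OF bilin_map_mult[OF assms(2)]] using assms(4) by (simp add: mult.assoc)
qed

text \<open>As \<open>S\<close> reverses products, the \<open>v\<close>-part of S(x_1) x_2 is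
  \<open>S x * q * x\<close> with q the sum of S(v_1) v_2. After inserting \<open>S x\<close> and
  moving \<open>x\<close> to the right, the coefficient \<alpha> \<sigma>(q) of x squared must
  vanish, so q = 0 because \<alpha> is a unit and \<sigma> is injective. The coefficient of
  \<open>x\<close> then gives \<open>S a\<close>.\<close>

lemma
  shows sum_S_v: "(\<Sum>p\<leftarrow>v. S (fst p) * snd p) = 0"
    and S_a: "S a = - (\<alpha> * \<sigma> b)"
proof -
  define q where "q = (\<Sum>p\<leftarrow>v. S (fst p) * snd p)"
  define q' where "q' = (\<Sum>p\<leftarrow>w. S (fst p) * snd p)"
  have qR: "q \<in> R" "q' \<in> R"
    unfolding q_def q'_def by (rule R_sum_list; simp)+
  have "bilin_map (\<lambda>s t. S s * t)"
    by (simp add: bilin_map_def algebra_simps)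
  hence "S a * x + S x * b + (\<Sum>p\<leftarrow>v. S x * (S (fst p) * snd p) * x) + q' = sc (e x) 1"
    using dsum_antipode_left[of x] by (simp add: dsum_x S_mult q'_def mult.assoc)
  also have "(\<Sum>p\<leftarrow>v. S x * (S (fst p) * snd p) * x) = S x * q * x"
    by (simp add: q_def sum_list_const_mult sum_list_mult_const)
  finally have eq: "S a * x + (\<alpha> * x + \<beta>) * b + (\<alpha> * x + \<beta>) * q * x + q' = sc (e x) 1"
    by (simp add: S_x)
  have 1: "(\<alpha> * x + \<beta>) * r = \<alpha> * \<sigma> r * x + \<alpha> * \<delta> r + \<beta> * r" if "r \<in> R" for r
    using x_comm[OF that] by (simp add: algebra_simps)
  have "(\<alpha> * \<delta> b + \<beta> * b + q' - sc (e x) 1) + (S a + \<alpha> * \<sigma> b + \<alpha> * \<delta> q + \<beta> * q) * x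
      + (\<alpha> * \<sigma> q) * x\<^sup>2 = 0"
    using eq unfolding 1[OF qR(1)] 1[OF abR(2)] by (simp add: algebra_simps power2_eq_square)
  hence 2: "S a + \<alpha> * \<sigma> b + \<alpha> * \<delta> q + \<beta> * q = 0" "\<alpha> * \<sigma> q = 0"
    by (rule ore_quadratic[rotated 3]; use qR in simp)+
  have "\<sigma> q = \<alpha>' * (\<alpha> * \<sigma> q)"
    by (simp add: alpha_inv mult.assoc[symmetric])
  hence "\<sigma> q = \<sigma> 0"
    using 2 by simp
  hence "q = 0"
    using inj_onD[OF sigma_inj _ qR(1) R_0] by blast
  moreover from this have "\<delta> q = 0"
    using delta_scale[of 1 0] by simp
  ultimately show "(\<Sum>p\<leftarrow>v. S (fst p) * snd p) = 0" "S a = - (\<alpha> * \<sigma> b)"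
    using 2 by (auto simp: q_def eq_neg_iff_add_eq_0)
qed

lemma sum_e_v: "(\<Sum>p\<leftarrow>v. e (fst p) * e (snd p)) = 0"
  using arg_cong[OF sum_S_v, of e] by (simp add: linear_form_sum_list[OF linear_form_e])

text \<open>The coefficient of \<open>x\<close> in the left counit axiom is e(a) + e(x) (e \<otimes>
  id)(v) = 1. A further application of \<open>e\<close> removes the \<open>v\<close>-term by
  \<open>sum_e_v\<close>.\<close>

lemma e_a: "e a = 1"
proof -
  have "bilin_map (\<lambda>s t. sc (e s) t)"
    by (simp add: bilin_map_def algebra_simps scale_right_distrib scale_left_distrib)
  hence eq: "sc (e a) x + sc (e x) b + (\<Sum>p\<leftarrow>v. sc (e (fst p * x)) (snd p * x)) +
     (\<Sum>p\<leftarrow>w. sc (e (fst p)) (snd p)) = x"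
    using dsum_counit_left[of x] by (simp only: dsum_x)
  let ?p = "\<Sum>p\<leftarrow>v. sc (e x) (sc (e (fst p)) (snd p))" and ?q = "\<Sum>p\<leftarrow>w. sc (e (fst p)) (snd p)"
  have R: "?p \<in> R" "?q \<in> R"
    by (rule R_sum_list; simp)+
  have "(\<Sum>p\<leftarrow>v. sc (e (fst p * x)) (snd p * x)) = ?p * x"
    by (simp add: sum_list_mult_const[symmetric] mult.commute)
  hence "(sc (e x) b + ?q) + (sc (e a) 1 + ?p - 1) * x + 0 * x\<^sup>2 = 0"
    using eq by (simp add: algebra_simps)
  hence "sc (e a) 1 + ?p - 1 = 0"
    by (rule ore_quadratic[rotated 3]; use R in simp)
  hence "e (sc (e a) 1 + ?p) = e 1"
    by simp
  moreover have "e ?p = e x * (\<Sum>p\<leftarrow>v. e (fst p) * e (snd p))"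
    by (simp add: linear_form_sum_list[OF linear_form_e] sum_list_const_mult[symmetric] mult_ac)
  ultimately show ?thesis
    by (simp add: sum_e_v)
qed

lemma e_b: "e b = 1"
proof -
  have "bilin_map (\<lambda>s t. sc (e t) s)"
    by (simp add: bilin_map_def algebra_simps scale_right_distrib scale_left_distrib)
  hence eq: "sc (e x) a + sc (e b) x + (\<Sum>p\<leftarrow>v. sc (e (snd p * x)) (fst p * x)) +
     (\<Sum>p\<leftarrow>w. sc (e (snd p)) (fst p)) = x"
    using dsum_counit_right[of x] by (simp only: dsum_x)
  let ?p = "\<Sum>p\<leftarrow>v. sc (e x) (sc (e (snd p)) (fst p))" and ?q = "\<Sum>p\<leftarrow>w. sc (e (snd p)) (fst p)"
  have R: "?p \<in> R" "?q \<in> R"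
    by (rule R_sum_list; simp)+
  have "(\<Sum>p\<leftarrow>v. sc (e (snd p * x)) (fst p * x)) = ?p * x"
    by (simp add: sum_list_mult_const[symmetric] mult.commute)
  hence "(sc (e x) a + ?q) + (sc (e b) 1 + ?p - 1) * x + 0 * x\<^sup>2 = 0"
    using eq by (simp add: algebra_simps)
  hence "sc (e b) 1 + ?p - 1 = 0"
    by (rule ore_quadratic[rotated 3]; use R in simp)
  hence "e (sc (e b) 1 + ?p) = e 1"
    by simp
  moreover have "e ?p = e x * (\<Sum>p\<leftarrow>v. e (fst p) * e (snd p))"
    by (simp add: linear_form_sum_list[OF linear_form_e] sum_list_const_mult[symmetric] mult_ac)
  ultimately show ?thesis
    by (simp add: sum_e_v)
qed

text \<open>In \<Delta>(r) \<Delta>(x) only the \<open>w\<close>-terms have degree 0 in both legs.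
  The factors S(r_1) r_2 then meet in the middle and collapse to e(r). This evaluates the
  \<open>v\<close>-terms in the coassociativity identities.\<close>

lemma dsum_S_w:
  assumes "r \<in> R"
  shows "dsum (\<lambda>s t. S (coef s 0) * coef t 0) (r * x) = sc (e r) (\<Sum>p\<leftarrow>w. S (fst p) * snd p)"
proof -
  let ?q = "\<lambda>c. \<Sum>p\<leftarrow>w. S (fst p) * (c * snd p)"
  have add: "(\<Sum>p\<leftarrow>w. S (fst p) * ((c + d) * snd p)) = ?q c + ?q d" for c d
    by (simp add: algebra_simps sum_list_addf)
  have scl: "(\<Sum>p\<leftarrow>w. S (fst p) * (sc k c * snd p)) = sc k (?q c)" for k c
    by (induction w) (simp_all add: scale_right_distrib)
  have "dsum (\<lambda>s t. S (coef s 0) * coef t 0) (r * x) = dsum (\<lambda>s t. ?q (S s * t)) r"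
  proof (rule dsum_Rx_cong)
    show "bilin_map (\<lambda>s t. S (coef s 0) * coef t 0)"
      by (simp add: bilin_map_def algebra_simps)
    show "bilin_map (\<lambda>s t. ?q (S s * t))"
      unfolding bilin_map_def using add scl by (simp add: distrib_left distrib_right)
  next
    fix s t assume st: "s \<in> R" "t \<in> R"
    have 1: "(\<Sum>p\<leftarrow>v. S (coef (s * fst p * x) 0) * coef (t * snd p * x) 0) = 0"
      by (rule sum_list_0) (simp add: st)
    have 2: "(\<Sum>p\<leftarrow>w. S (coef (s * fst p) 0) * coef (t * snd p) 0) = ?q (S s * t)"
      by (rule sum_list_cong) (simp add: st S_mult mult.assoc)
    show "S (coef (s * a) 0) * coef (t * x) 0 + S (coef (s * x) 0) * coef (t * b) 0 +
        (\<Sum>p\<leftarrow>v. S (coef (s * fst p * x) 0) * coef (t * snd p * x) 0) +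
        (\<Sum>p\<leftarrow>w. S (coef (s * fst p) 0) * coef (t * snd p) 0) = ?q (S s * t)"
      unfolding 1 2 using st by simp
  qed (rule assms)
  also have "\<dots> = ?q (dsum (\<lambda>s t. S s * t) r)"
    by (rule dsum_additive[symmetric, where h = ?q]) (rule add)
  also have "\<dots> = sc (e r) (\<Sum>p\<leftarrow>w. S (fst p) * snd p)"
    using scl[of "e r" 1] by (simp add: dsum_antipode_left)
  finally show ?thesis .
qed

lemma coef0_antipode_R:
  assumes "r \<in> R"
  shows "dsum (\<lambda>s t. S (coef s 0) * coef t 0) r = sc (e r) 1"
proof -
  have "dsum (\<lambda>s t. S (coef s 0) * coef t 0) r = dsum (\<lambda>s t. S s * t) r"
    using assms by (rule dsum_cong_R) (simp_all add: bilin_map_def algebra_simps)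
  thus ?thesis
    by (simp add: dsum_antipode_left)
qed

text \<open>Coassociativity at \<open>x\<close>, compared in the coefficient of \<open>1 \<otimes> 1 \<otimes> x\<close>.\<close>

lemma S_a_a: "S a * a = 1"
proof -
  \<comment> \<open>The test map selects degree (0,0,1), applies S \<otimes> id followed by
    multiplication to the first two legs and \<open>e\<close> to the last coefficient.\<close>
  let ?P = "\<lambda>s t u. sc (e (coef u 1)) (S (coef s 0) * coef t 0)"
  let ?W = "\<Sum>p\<leftarrow>w. S (fst p) * snd p"
  have tri: "trilin_map ?P"
    by (simp add: trilin_map_def algebra_simps)
  have bi: "bilin_map (?P s)" for s
    using tri by (simp add: trilin_map_def bilin_map_def)
  \<comment> \<open>Splitting the left leg: a \<otimes> x gives S(a_1) a_2 = e(a), and the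
    \<open>v\<close>-terms sum to (e \<otimes> e)(v) times \<open>?W\<close>, which is 0.\<close>
  have "dsum (\<lambda>s t. dsum (\<lambda>s' t'. ?P s' t' t) s) x = sc (e a) 1"
  proof -
    have 1: "(\<Sum>p\<leftarrow>v. dsum (\<lambda>s' t'. ?P s' t' (snd p * x)) (fst p * x)) =
        (\<Sum>p\<leftarrow>v. sc (e (fst p) * e (snd p)) ?W)"
      by (rule sum_list_cong) (simp add: dsum_arg_scale dsum_S_w mult.commute)
    have 2: "(\<Sum>p\<leftarrow>v. sc (e (fst p) * e (snd p)) ?W) = sc (\<Sum>p\<leftarrow>v. e (fst p) * e (snd p)) ?W"
      by (induction v) (simp_all add: scale_left_distrib)
    have 3: "(\<Sum>p\<leftarrow>w. dsum (\<lambda>s' t'. ?P s' t' (snd p)) (fst p)) = 0"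
      by (rule sum_list_0) simp
    show ?thesis
      unfolding dsum_x[OF bilin_map_dsum_left[OF tri]] 1 2 3 sum_e_v
      by (simp add: dsum_arg_scale coef0_antipode_R)
  qed
  \<comment> \<open>Splitting the right leg: only a \<otimes> a \<otimes> x has the selected
    degree.\<close>
  moreover have "dsum (\<lambda>s t. dsum (\<lambda>s' t'. ?P s s' t') t) x = S a * a"
  proof -
    have 1: "(\<Sum>p\<leftarrow>v. dsum (\<lambda>s' t'. ?P (fst p * x) s' t') (snd p * x)) = 0"
      by (rule sum_list_0) simp
    have 2: "(\<Sum>p\<leftarrow>w. dsum (\<lambda>s' t'. ?P (fst p) s' t') (snd p)) = 0"
      by (intro sum_list_0 dsum_R_0 bi) simp_all
    have 3: "(\<Sum>p\<leftarrow>v. ?P a (fst p * x) (snd p * x)) = 0"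
      by (rule sum_list_0) simp
    have 4: "(\<Sum>p\<leftarrow>w. ?P a (fst p) (snd p)) = 0"
      by (rule sum_list_0) simp
    have 5: "dsum (?P a) x = S a * a"
      unfolding dsum_x[OF bi] 3 4 by simp
    have 6: "dsum (?P x) b = 0"
      by simp
    show ?thesis
      unfolding dsum_x[OF bilin_map_dsum_right[OF tri]] 1 2 5 6 by simp
  qed
  ultimately show ?thesis
    using dsum_coassoc[OF tri, of x] by (simp add: e_a)
qed

text \<open>The same for the coefficient of \<open>x \<otimes> 1 \<otimes> 1\<close>.\<close>

lemma S_b_b: "S b * b = 1"
proof -
  let ?P = "\<lambda>s t u. sc (e (coef s 1)) (S (coef t 0) * coef u 0)"
  let ?W = "\<Sum>p\<leftarrow>w. S (fst p) * snd p"
  have tri: "trilin_map ?P"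
    by (simp add: trilin_map_def algebra_simps)
  have bi: "bilin_map (\<lambda>s t. ?P s t u)" for u
    using tri by (simp add: trilin_map_def bilin_map_def)
  have "dsum (\<lambda>s t. dsum (\<lambda>s' t'. ?P s s' t') t) x = sc (e b) 1"
  proof -
    have 1: "(\<Sum>p\<leftarrow>v. dsum (\<lambda>s' t'. ?P (fst p * x) s' t') (snd p * x)) =
        (\<Sum>p\<leftarrow>v. sc (e (fst p) * e (snd p)) ?W)"
      by (rule sum_list_cong) (simp add: dsum_arg_scale dsum_S_w)
    have 2: "(\<Sum>p\<leftarrow>v. sc (e (fst p) * e (snd p)) ?W) = sc (\<Sum>p\<leftarrow>v. e (fst p) * e (snd p)) ?W"
      by (induction v) (simp_all add: scale_left_distrib)
    have 3: "(\<Sum>p\<leftarrow>w. dsum (\<lambda>s' t'. ?P (fst p) s' t') (snd p)) = 0"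
      by (rule sum_list_0) simp
    show ?thesis
      unfolding dsum_x[OF bilin_map_dsum_right[OF tri]] 1 2 3 sum_e_v
      by (simp add: dsum_arg_scale coef0_antipode_R)
  qed
  moreover have "dsum (\<lambda>s t. dsum (\<lambda>s' t'. ?P s' t' t) s) x = S b * b"
  proof -
    have 1: "(\<Sum>p\<leftarrow>v. dsum (\<lambda>s' t'. ?P s' t' (snd p * x)) (fst p * x)) = 0"
      by (rule sum_list_0) simp
    have 2: "(\<Sum>p\<leftarrow>w. dsum (\<lambda>s' t'. ?P s' t' (snd p)) (fst p)) = 0"
      by (intro sum_list_0 dsum_R_0 bi) simp_all
    have 3: "(\<Sum>p\<leftarrow>v. ?P (fst p * x) (snd p * x) b) = 0"
      by (rule sum_list_0) simp
    have 4: "(\<Sum>p\<leftarrow>w. ?P (fst p) (snd p) b) = 0"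
      by (rule sum_list_0) simp
    have 5: "dsum (\<lambda>s t. ?P s t b) x = S b * b"
      unfolding dsum_x[OF bi] 3 4 by simp
    have 6: "dsum (\<lambda>s t. ?P s t x) a = 0"
      by simp
    show ?thesis
      unfolding dsum_x[OF bilin_map_dsum_left[OF tri]] 1 2 5 6 by simp
  qed
  ultimately show ?thesis
    using dsum_coassoc[OF tri, of x] by (simp add: e_b)
qed

text \<open>With \<open>S_a\<close>, the identity S(a) a = 1 provides the right inverse -a\<alpha>
  of \<sigma>(b), while S(b) b = 1 provides the left inverse \<sigma>(S(b)). The two agree, which
  turns both one-sided inverses into two-sided ones.\<close>

lemma
  shows a_S_a: "a * S a = 1"
    and b_S_b: "b * S b = 1"
proof -
  have "\<alpha> * (\<sigma> b * a) = - 1"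
    using S_a_a by (simp add: S_a mult.assoc minus_equation_iff[of _ 1])
  hence "\<alpha>' * (\<alpha> * (\<sigma> b * a)) = - \<alpha>'"
    by simp
  hence "\<sigma> b * a = - \<alpha>'"
    by (simp add: mult.assoc[symmetric] alpha_inv)
  hence right: "\<sigma> b * (- (a * \<alpha>)) = 1"
    by (simp add: mult.assoc[symmetric] alpha_inv)
  have left: "\<sigma> (S b) * \<sigma> b = 1"
    using S_b_b by (simp add: sigma_mult[symmetric])
  have eq: "\<sigma> (S b) = - (a * \<alpha>)"
    using left right by (metis mult.assoc mult.left_neutral mult.right_neutral)
  show "a * S a = 1"
    using left unfolding eq by (simp add: S_a mult.assoc)
  have "\<sigma> (b * S b) = \<sigma> 1"
    using right eq by (simp add: sigma_mult)
  thus "b * S b = 1"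
    using inj_onD[OF sigma_inj, of "b * S b" 1] by simp
qed

text \<open>The coefficient of \<open>1 \<otimes> x \<otimes> x\<close>.\<close>

lemma sum_e_v_left: "(\<Sum>p\<leftarrow>v. sc (e (fst p)) (snd p)) = 0"
proof -
  let ?P = "\<lambda>s t u. sc (e (coef t 1)) (S (coef s 0) * coef u 1)"
  let ?p = "\<Sum>p\<leftarrow>v. sc (e (fst p)) (snd p)"
  have tri: "trilin_map ?P"
    by (simp add: trilin_map_def algebra_simps)
  have bi: "bilin_map (?P s)" for s
    using tri by (simp add: trilin_map_def bilin_map_def)
  have bi': "bilin_map (\<lambda>s t. ?P s t u)" for u
    using tri by (simp add: trilin_map_def bilin_map_def)
  \<comment> \<open>Here only a \<otimes> v(x \<otimes> x) has degree (0,1,1).\<close>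
  have "dsum (\<lambda>s t. dsum (\<lambda>s' t'. ?P s s' t') t) x = S a * ?p"
  proof -
    have 1: "(\<Sum>p\<leftarrow>v. dsum (\<lambda>s' t'. ?P (fst p * x) s' t') (snd p * x)) = 0"
      by (rule sum_list_0) simp
    have 2: "(\<Sum>p\<leftarrow>w. dsum (\<lambda>s' t'. ?P (fst p) s' t') (snd p)) = 0"
      by (intro sum_list_0 dsum_R_0 bi) simp_all
    have 3: "(\<Sum>p\<leftarrow>v. ?P a (fst p * x) (snd p * x)) = S a * ?p"
      unfolding sum_list_const_mult[symmetric] by (rule sum_list_cong) simp
    have 4: "(\<Sum>p\<leftarrow>w. ?P a (fst p) (snd p)) = 0"
      by (rule sum_list_0) simp
    have 5: "dsum (?P a) x = S a * ?p"
      unfolding dsum_x[OF bi] 3 4 by simp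
    have 6: "dsum (?P x) b = 0"
      by simp
    show ?thesis
      unfolding dsum_x[OF bilin_map_dsum_right[OF tri]] 1 2 5 6 by simp
  qed
  moreover have "dsum (\<lambda>s t. dsum (\<lambda>s' t'. ?P s' t' t) s) x = 0"
  proof -
    \<comment> \<open>The degree (0,1) part of \<Delta>(v_1 x) comes from \<Delta>(v_1)(a \<otimes>
      x). The counit reduces it to S(v_1 a) v_2, and these terms cancel in total by
      \<open>sum_S_v\<close>.\<close>
    have "dsum (\<lambda>s' t'. ?P s' t' (snd p * x)) (fst p * x) = S a * (S (fst p) * snd p)"
      if p: "p \<in> set v" for p
    proof -
      have "dsum (\<lambda>s' t'. ?P s' t' (snd p * x)) (fst p * x) =
          dsum (\<lambda>s t. S (sc (e t) s * a) * snd p) (fst p)"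
      proof (rule dsum_Rx_cong[OF _ bi'])
        show "bilin_map (\<lambda>s t. S (sc (e t) s * a) * snd p)"
          by (simp add: bilin_map_def algebra_simps)
      next
        fix s t assume st: "s \<in> R" "t \<in> R"
        have 1: "(\<Sum>q\<leftarrow>v. ?P (s * fst q * x) (t * snd q * x) (snd p * x)) = 0"
          by (rule sum_list_0) (simp add: st p)
        have 2: "(\<Sum>q\<leftarrow>w. ?P (s * fst q) (t * snd q) (snd p * x)) = 0"
          by (rule sum_list_0) (simp add: st p)
        show "?P (s * a) (t * x) (snd p * x) + ?P (s * x) (t * b) (snd p * x) +
            (\<Sum>q\<leftarrow>v. ?P (s * fst q * x) (t * snd q * x) (snd p * x)) +
            (\<Sum>q\<leftarrow>w. ?P (s * fst q) (t * snd q) (snd p * x)) = S (sc (e t) s * a) * snd p"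
          unfolding 1 2 using st p by simp
      qed (simp add: p)
      also have "\<dots> = S (dsum (\<lambda>s t. sc (e t) s) (fst p) * a) * snd p"
        by (rule dsum_additive[symmetric, where h = "\<lambda>z. S (z * a) * snd p"])
          (simp add: algebra_simps)
      finally show ?thesis
        by (simp add: dsum_counit_right S_mult mult.assoc)
    qed
    hence "(\<Sum>p\<leftarrow>v. dsum (\<lambda>s' t'. ?P s' t' (snd p * x)) (fst p * x)) =
        (\<Sum>p\<leftarrow>v. S a * (S (fst p) * snd p))"
      by (rule sum_list_cong)
    hence 1: "(\<Sum>p\<leftarrow>v. dsum (\<lambda>s' t'. ?P s' t' (snd p * x)) (fst p * x)) = 0"
      by (simp add: sum_list_const_mult sum_S_v)
    have 2: "(\<Sum>p\<leftarrow>w. dsum (\<lambda>s' t'. ?P s' t' (snd p)) (fst p)) = 0"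
      by (rule sum_list_0) simp
    have 3: "dsum (\<lambda>s t. ?P s t b) x = 0"
      by simp
    have 4: "dsum (\<lambda>s t. ?P s t x) a = 0"
      by (intro dsum_R_0 bi') simp_all
    show ?thesis
      unfolding dsum_x[OF bilin_map_dsum_left[OF tri]] 1 2 3 4 by simp
  qed
  ultimately have "S a * ?p = 0"
    using dsum_coassoc[OF tri, of x] by simp
  hence "a * (S a * ?p) = 0"
    by simp
  thus ?thesis
    by (simp add: mult.assoc[symmetric] a_S_a)
qed

text \<open>Only the values of \<open>chi\<close> on \<open>R\<close> matter; the projection to \<open>R\<close> makes it a linear form on all of \<open>T\<close>.\<close>

definition chi :: "'a \<Rightarrow> 'f" where
  "chi t = e (\<sigma> (coef t 0))"

definition tau :: "'a \<Rightarrow> 'a" where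
  "tau = dsum (\<lambda>s t. sc (chi s) t)"

lemma chi_add [simp]: "chi (s + t) = chi s + chi t"
  by (simp add: chi_def sigma_add)

lemma chi_scale [simp]: "chi (sc k t) = k * chi t"
  by (simp add: chi_def sigma_scale)

lemma bilin_map_chi: "bilin_map (\<lambda>s t. sc (chi s) t)"
  by (simp add: bilin_map_def algebra_simps)

lemma tau_add: "tau (s + t) = tau s + tau t"
  unfolding tau_def by (rule dsum_add[OF bilin_map_chi])

lemma tau_scale: "tau (sc k t) = sc k (tau t)"
  unfolding tau_def by (rule dsum_scale[OF bilin_map_chi])

text \<open>The coefficient of \<open>x \<otimes> 1\<close> in \<open>\<Delta>(x r) = \<Delta>(\<sigma>(r) x + \<delta>(r))\<close> shows that \<open>\<sigma>\<close> is, up to an inner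
  automorphism, the winding automorphism \<open>tau\<close>.\<close>

lemma b_tau:
  assumes r: "r \<in> R"
  shows "b * tau r = \<sigma> r * b"
proof -
  \<comment> \<open>Selects degree (1,0) and applies \<open>e\<close> to the first
    coefficient.\<close>
  let ?P = "\<lambda>s t. sc (e (coef s 1)) (coef t 0)"
  have bi: "bilin_map ?P"
    by (simp add: bilin_map_def algebra_simps)
  have "dsum ?P (\<sigma> r * x) = dsum (\<lambda>s t. sc (e s) t * b) (\<sigma> r)"
  proof (rule dsum_Rx_cong[OF _ bi])
    show "bilin_map (\<lambda>s t. sc (e s) t * b)"
      by (simp add: bilin_map_def algebra_simps)
  next
    fix s t assume st: "s \<in> R" "t \<in> R"
    have 1: "(\<Sum>q\<leftarrow>v. ?P (s * fst q * x) (t * snd q * x)) = 0"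
      by (rule sum_list_0) (simp add: st)
    have 2: "(\<Sum>q\<leftarrow>w. ?P (s * fst q) (t * snd q)) = 0"
      by (rule sum_list_0) (simp add: st)
    show "?P (s * a) (t * x) + ?P (s * x) (t * b) +
        (\<Sum>q\<leftarrow>v. ?P (s * fst q * x) (t * snd q * x)) + (\<Sum>q\<leftarrow>w. ?P (s * fst q) (t * snd q)) =
        sc (e s) t * b"
      unfolding 1 2 using st by (simp add: e_b)
  qed (simp add: r)
  also have "\<dots> = \<sigma> r * b"
    unfolding dsum_mult_right dsum_counit_left ..
  finally have 1: "dsum ?P (\<sigma> r * x) = \<sigma> r * b" .
  have 2: "dsum ?P (\<delta> r) = 0"
    by (intro dsum_R_0 bi) (simp_all add: r)
  \<comment> \<open>A first leg in R stays in R after multiplication by r_1; this disposes of the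
    terms a \<otimes> x and \<open>w\<close>.\<close>
  have inner: "dsum (\<lambda>s' t'. ?P (s * s') (t * t')) r = 0" if "s \<in> R" for s t
    by (intro dsum_R_0 bilin_map_mult[OF bi]) (simp_all add: r that)
  have "dsum ?P (x * r) = dsum (\<lambda>s t. dsum (\<lambda>s' t'. ?P (s * s') (t * t')) r) x"
    by (rule dsum_mult[OF bi])
  also have "\<dots> = b * tau r"
  proof -
    have 1: "dsum (\<lambda>s' t'. ?P (x * s') (b * t')) r = dsum (\<lambda>s t. b * sc (chi s) t) r"
    proof (rule dsum_cong_R[OF r bilin_map_mult[OF bi]])
      show "bilin_map (\<lambda>s t. b * sc (chi s) t)"
        by (simp add: bilin_map_def algebra_simps)
    qed (simp add: x_comm chi_def)
    \<comment> \<open>The \<open>v\<close>-terms give e(v_1) v_2 times a factor independent of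
      \<open>v\<close>, so they vanish in total by \<open>sum_e_v_left\<close>. The factor is
      written with \<open>coef (x * t) 0\<close> instead of \<open>\<delta> t\<close>, because
      bilinearity is required on all of T and \<delta> is linear only on R.\<close>
    have "dsum (\<lambda>s' t'. ?P (fst p * x * s') (snd p * x * t')) r =
        sc (e (fst p)) (snd p) * dsum (\<lambda>s t. sc (chi s) (coef (x * t) 0)) r" if p: "p \<in> set v" for p
    proof -
      have "dsum (\<lambda>s' t'. ?P (fst p * x * s') (snd p * x * t')) r =
          dsum (\<lambda>s t. sc (e (fst p)) (snd p) * sc (chi s) (coef (x * t) 0)) r"
      proof (rule dsum_cong_R[OF r bilin_map_mult[OF bi]])
        show "bilin_map (\<lambda>s t. sc (e (fst p)) (snd p) * sc (chi s) (coef (x * t) 0))"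
          by (simp add: bilin_map_def algebra_simps)
      next
        fix s t assume st: "s \<in> R" "t \<in> R"
        have "u * x * z = (u * \<sigma> z) * x + u * \<delta> z" if "u \<in> R" "z \<in> R" for u z
          using that by (simp add: mult.assoc x_comm distrib_left)
        thus "?P (fst p * x * s) (snd p * x * t) = sc (e (fst p)) (snd p) * sc (chi s) (coef (x * t) 0)"
          using st p by (simp add: x_comm chi_def)
      qed
      thus ?thesis
        by (simp only: dsum_mult_left)
    qed
    hence "(\<Sum>p\<leftarrow>v. dsum (\<lambda>s' t'. ?P (fst p * x * s') (snd p * x * t')) r) =
        (\<Sum>p\<leftarrow>v. sc (e (fst p)) (snd p) * dsum (\<lambda>s t. sc (chi s) (coef (x * t) 0)) r)"
      by (rule sum_list_cong)
    hence 2: "(\<Sum>p\<leftarrow>v. dsum (\<lambda>s' t'. ?P (fst p * x * s') (snd p * x * t')) r) = 0"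
      by (simp only: sum_list_mult_const sum_e_v_left mult_zero_left)
    have 3: "(\<Sum>p\<leftarrow>w. dsum (\<lambda>s' t'. ?P (fst p * s') (snd p * t')) r) = 0"
      by (rule sum_list_0, rule inner) simp
    show ?thesis
      unfolding dsum_x[OF bilin_map_dsum_mult[OF bi]] 1 2 3
      by (simp add: inner dsum_mult_left tau_def del: mult_scale_right One_nat_def)
  qed
  finally have "b * tau r = dsum ?P (x * r)" ..
  also have "\<dots> = \<sigma> r * b"
    unfolding x_comm[OF r] dsum_add[OF bi] 1 2 by simp
  finally show ?thesis .
qed

lemma tau_eq: "r \<in> R \<Longrightarrow> tau r = S b * \<sigma> r * b"
  using b_tau[of r] by (metis S_b_b mult.assoc mult.left_neutral)

lemma tau_mult:
  assumes "r \<in> R" "s \<in> R"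
  shows "tau (r * s) = tau r * tau s"
proof -
  have "tau r * tau s = S b * \<sigma> r * (b * S b) * \<sigma> s * b"
    using assms by (simp add: tau_eq mult.assoc)
  thus ?thesis
    using assms by (simp add: tau_eq b_S_b sigma_mult mult.assoc)
qed

section \<open>The new variable and its twisted derivation\<close>

definition xn :: 'a where "xn = S b * x"

definition dn :: "'a \<Rightarrow> 'a" where "dn r = S b * \<delta> r"

text \<open>\<open>S b\<close> is the inverse of \<open>b\<close>, so passing from \<open>x\<close>
  to \<open>xn\<close> conjugates \<sigma> into \<open>tau\<close>.\<close>

lemma xn_comm: "r \<in> R \<Longrightarrow> xn * r = tau r * xn + dn r"
proof -
  assume r: "r \<in> R"
  have "tau r * xn = S b * \<sigma> r * (b * S b) * x"
    by (simp add: xn_def tau_eq[OF r] mult.assoc)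
  thus ?thesis
    by (simp add: xn_def dn_def b_S_b x_comm[OF r] mult.assoc distrib_left)
qed

lemma dn_R [simp]: "r \<in> R \<Longrightarrow> dn r \<in> R"
  by (simp add: dn_def)

lemma dn_add: "r \<in> R \<Longrightarrow> s \<in> R \<Longrightarrow> dn (r + s) = dn r + dn s"
  by (simp add: dn_def delta_add distrib_left)

lemma dn_scale: "r \<in> R \<Longrightarrow> dn (sc k r) = sc k (dn r)"
  by (simp add: dn_def delta_scale)

lemma dn_mult:
  assumes "r \<in> R" "s \<in> R"
  shows "dn (r * s) = tau r * dn s + dn r * s"
proof -
  have "tau r * dn s = S b * \<sigma> r * (b * S b) * \<delta> s"
    using assms by (simp add: dn_def tau_eq mult.assoc)
  thus ?thesis
    using assms by (simp add: dn_def b_S_b delta_mult distrib_left mult.assoc)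
qed

lemma b_xn: "b * xn = x"
  by (simp add: xn_def mult.assoc[symmetric] b_S_b)

text \<open>The left slices \<open>(f \<otimes> id)(\<Delta> r)\<close> span a finite-dimensional space, and coassociativity makes it
  invariant under the winding automorphism.\<close>

lemma tau_locally_finite:
  assumes r: "r \<in> R"
  shows "\<exists>B. finite B \<and> B \<subseteq> R \<and> r \<in> span B \<and> (\<forall>t\<in>B. tau t \<in> span B)"
proof -
  obtain ts where ts: "set ts \<subseteq> R \<times> R" "teq sc (D r) ts"
    using hopf_subalg r unfolding hopf_subalg_def by blast
  \<comment> \<open>All left slices of \<Delta>(r). Evaluating them on \<open>ts\<close> instead of
    \<open>D r\<close> shows that they lie in R and in the span of finitely many second
    legs.\<close>
  define C where "C = {dsum (\<lambda>s t. sc (f s) t) r | f. linear_form f}"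
  have bi: "bilin_map (\<lambda>s t. sc (f s) t)" if "linear_form f" for f
    using that by (simp add: linear_form_def bilin_map_def algebra_simps)
  have C_eq: "dsum (\<lambda>s t. sc (f s) t) r = (\<Sum>p\<leftarrow>ts. sc (f (fst p)) (snd p))" if "linear_form f" for f
    using dsum_teq[OF ts(2) bi[OF that]] .
  have "(\<Sum>p\<leftarrow>us. sc (f (fst p)) (snd p)) \<in> span (snd ` set us)" for f us
  proof (induction us)
    case (Cons p us)
    have "span (snd ` set us) \<subseteq> span (snd ` set (p # us))"
      by (rule span_mono) auto
    thus ?case
      using Cons by (simp, intro span_add span_scale) (auto intro: span_base)
  qed (simp add: span_zero)
  hence C_span: "C \<subseteq> span (snd ` set ts)"
    unfolding C_def using C_eq by auto
  have C_R: "C \<subseteq> R"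
    unfolding C_def using C_eq ts(1) by (fastforce intro!: R_sum_list R_scale)
  \<comment> \<open>The slice along the counit is \<open>r\<close> itself.\<close>
  have C_r: "r \<in> C"
    unfolding C_def using linear_form_e dsum_counit_left[of r] by force
  have C_tau: "tau t \<in> C" if t: "t \<in> C" for t
  proof -
    obtain f where f: "linear_form f" "t = dsum (\<lambda>s t. sc (f s) t) r"
      using t unfolding C_def by blast
    have f_add: "f (p + q) = f p + f q" and f_sc: "f (sc k p) = k * f p" for k p q
      using f(1) by (simp_all add: linear_form_def)
    let ?P = "\<lambda>s t u. sc (f s * chi t) u"
    have tri: "trilin_map ?P"
      by (simp add: trilin_map_def algebra_simps f_add f_sc)
    \<comment> \<open>The convolution product of \<open>f\<close> and \<open>chi\<close>: by
      coassociativity \<open>tau\<close> sends the slice along \<open>f\<close> to the slice along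
      \<open>?g\<close>.\<close>
    let ?g = "\<lambda>s. \<Sum>p\<leftarrow>D s. f (fst p) * chi (snd p)"
    have bf: "bilin sc (\<lambda>s t. f s * chi t)"
      by (simp add: bilin_def algebra_simps f_add f_sc)
    have teqD: "teq sc (D (p + q)) (D p @ D q)" "teq sc (D (sc k p)) (tscale sc k (D p))" for k p q
      using hopf_alg by (simp_all add: hopf_alg_def)
    have g: "linear_form ?g"
    proof -
      have "(\<Sum>p\<leftarrow>tscale sc k us. f (fst p) * chi (snd p)) = k * (\<Sum>p\<leftarrow>us. f (fst p) * chi (snd p))" for k us
        by (induction us) (simp_all add: tscale_def f_sc algebra_simps)
      thus ?thesis
        using teqD[unfolded teq_def, rule_format, OF bf] by (simp add: linear_form_def)
    qed
    have "tau t = dsum (\<lambda>s t. tau (sc (f s) t)) r"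
      unfolding f(2) by (rule dsum_additive) (rule tau_add)
    also have "\<dots> = dsum (\<lambda>s t. dsum (\<lambda>s' t'. ?P s s' t') t) r"
      by (simp add: tau_scale, simp add: tau_def dsum_arg_scale[symmetric])
    also have "\<dots> = dsum (\<lambda>s t. dsum (\<lambda>s' t'. ?P s' t' t) s) r"
      by (rule dsum_coassoc[OF tri, symmetric])
    also have "\<dots> = dsum (\<lambda>s t. sc (?g s) t) r"
    proof -
      have "(\<Sum>p\<leftarrow>us. sc (f (fst p) * chi (snd p)) t) = sc (\<Sum>p\<leftarrow>us. f (fst p) * chi (snd p)) t" for us t
        by (induction us) (simp_all add: scale_left_distrib)
      thus ?thesis
        by (simp add: dsum_def)
    qed
    finally show ?thesis
      unfolding C_def mem_Collect_eq using g by (intro exI[of _ ?g] conjI)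
  qed
  obtain B where B: "B \<subseteq> C" "independent B" "C \<subseteq> span B"
    using basis_exists[of C] by metis
  have "finite B"
    using independent_span_bound[of "snd ` set ts" B] B C_span by auto
  thus ?thesis
    using B C_R C_r C_tau by (intro exI[of _ B]) blast
qed

end

section \<open>Growth of Hopf Ore extensions\<close>

context hopf_ore
begin

section \<open>Lower bound from freeness, upper bound from a normal form\<close>

lemma subspace_R: "subspace R"
  by (simp add: subspace_def)

lemma powsp_subset_R: "B \<subseteq> R \<Longrightarrow> powsp sc B n \<subseteq> R"
  by (rule powsp_subsetI) (auto simp: subspace_R)

text \<open>For a basis \<open>C\<close> of the \<open>n\<close>-th power of \<open>B\<close>, the
  products \<open>c * x ^ i\<close> with i \<le> n are independent by freeness over R and lie in the
  power 2n.\<close>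

lemma dim_powsp_insert_x:
  assumes "finite B" "B \<subseteq> R" "1 \<in> B"
  shows "(n + 1) * dim (powsp sc B n) \<le> dim (powsp sc (insert x B) (2 * n))"
proof -
  obtain C where C: "finite C" "C \<subseteq> powsp sc B n" "independent C" "card C = dim (powsp sc B n)"
    using powsp_basis[OF assms(1)] by metis
  have CR: "C \<subseteq> R"
    using C(2) powsp_subset_R[OF assms(2)] by blast
  let ?I = "C \<times> {..<Suc n}" and ?g = "\<lambda>(c, i). c * x ^ i"
  have fin: "finite ?I"
    using C(1) by simp
  have zero: "u j = 0" if u: "(\<Sum>j\<in>?I. sc (u j) (?g j)) = 0" "j \<in> ?I" for u j
  proof -
    obtain c i where j: "j = (c, i)" "c \<in> C" "i < Suc n"
      using u(2) by auto
    \<comment> \<open>Collecting powers of \<open>x\<close> gives coefficients in R, each of which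
      vanishes by freeness and is then a relation among basis elements.\<close>
    have "(\<Sum>j\<in>?I. sc (u j) (?g j)) = (\<Sum>c\<in>C. \<Sum>i<Suc n. sc (u (c, i)) (c * x ^ i))"
      by (simp only: sum.cartesian_product split_def prod.collapse)
    also have "\<dots> = (\<Sum>i<Suc n. \<Sum>c\<in>C. sc (u (c, i)) (c * x ^ i))"
      by (rule sum.swap)
    also have "\<dots> = (\<Sum>i<Suc n. (\<Sum>c\<in>C. sc (u (c, i)) c) * x ^ i)"
      by (simp only: sum_distrib_right mult_scale_left)
    finally have "(\<Sum>i<Suc n. (\<Sum>c\<in>C. sc (u (c, i)) c) * x ^ i) = 0"
      using u(1) by simp
    hence "(\<Sum>c\<in>C. sc (u (c, i)) c) = 0"
      by (rule ore_indep[rotated]) (use CR j in \<open>auto intro!: R_sum R_scale\<close>)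
    thus ?thesis
      using independentD[OF C(3,1) subset_refl, of "\<lambda>c. u (c, i)"] j by simp
  qed
  have inj: "inj_on ?g ?I" "independent (?g ` ?I)"
    by (rule inj_independent_imageI[OF fin], rule zero, assumption, assumption)+
  have "?g ` ?I \<subseteq> powsp sc (insert x B) (2 * n)"
  proof safe
    fix c i assume "c \<in> C" "i < Suc n"
    hence "c \<in> powsp sc (insert x B) n" "x ^ i \<in> powsp sc (insert x B) n"
      using C(2) powsp_mono[of B "insert x B" n] powsp_pow[of x "insert x B" i n] assms(3) by auto
    from powsp_mult[OF this] show "c * x ^ i \<in> powsp sc (insert x B) (2 * n)"
      by (simp add: mult_2)
  qed
  hence "card (?g ` ?I) \<le> dim (powsp sc (insert x B) (2 * n))"
    using inj assms(1) by (intro independent_card_le_dim_powsp) auto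
  also have "card (?g ` ?I) = (n + 1) * dim (powsp sc B n)"
    using card_image[OF inj(1)] C by (simp add: card_cartesian_product)
  finally show ?thesis .
qed

text \<open>Moving \<open>xn\<close> to the right past \<open>r\<close> yields
  \<open>tau r * xn + dn r\<close>. Here \<open>tau\<close> preserves each power of \<open>V\<close>
  and \<open>dn\<close> raises the exponent by at most \<open>m\<close>, while a letter of
  \<open>V\<close> raises it by 1. So m + 1 per letter covers every case.\<close>

lemma powsp_insert_xn:
  assumes V: "V \<subseteq> R" "1 \<in> V" "tau ` V \<subseteq> span V" "dn ` V \<subseteq> powsp sc V m"
  shows "powsp sc (insert xn V) n \<subseteq>
    span {r * xn ^ i | r i. r \<in> powsp sc V ((m + 1) * n) \<and> i \<le> n}"
proof -
  define E where "E n = span {r * xn ^ i | r i. r \<in> powsp sc V ((m + 1) * n) \<and> i \<le> n}" for n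
  have VR: "r \<in> R" if "r \<in> powsp sc V N" for r N
    using powsp_subset_R[OF V(1)] that by blast
  have tau_powsp: "tau r \<in> powsp sc V N" if "r \<in> powsp sc V N" for r N
  proof -
    \<comment> \<open>Membership in R is carried along because \<open>tau\<close> is multiplicative
      on R.\<close>
    have "powsp sc V N \<subseteq> {r \<in> R. tau r \<in> powsp sc V N}"
    proof (rule powsp_subsetI)
      show "subspace {r \<in> R. tau r \<in> powsp sc V n}" for n
        using subspace_powsp[of V n] tau_scale[of 0 0]
        by (auto simp: subspace_def tau_add tau_scale)
      show "1 \<in> {r \<in> R. tau r \<in> powsp sc V 0}"
        using powsp_prod_listI[of "[]" 0 V] by (simp add: tau_eq S_b_b)
      fix n c t assume "c \<in> V" and t: "t \<in> {r \<in> R. tau r \<in> powsp sc V n}"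
      hence "tau c \<in> powsp sc V 1" "c \<in> R"
        using V(1,3) powsp_base[of "tau c" "span V"] by (auto simp: powsp_span)
      thus "c * t \<in> {r \<in> R. tau r \<in> powsp sc V (Suc n)}"
        using t powsp_mult[of "tau c" V 1 "tau t" n] by (simp add: tau_mult)
    qed
    thus ?thesis
      using that by blast
  qed
  have dn_powsp: "dn r \<in> powsp sc V (N + m)" if "r \<in> powsp sc V N" for r N
  proof -
    \<comment> \<open>The induction also keeps track of the power containing \<open>t\<close>, since
      the Leibniz rule for \<open>dn (c * t)\<close> contains the term
      \<open>dn c * t\<close>.\<close>
    have "powsp sc V N \<subseteq> {r \<in> powsp sc V N. dn r \<in> powsp sc V (N + m)}"
    proof (rule powsp_subsetI)
      show "subspace {r \<in> powsp sc V n. dn r \<in> powsp sc V (n + m)}" for n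
        using subspace_powsp[of V "n + m"] subspace_powsp[of V n] dn_scale[of 0 0] VR[of _ n]
        unfolding subspace_def by (auto simp: dn_add dn_scale)
      have "dn 1 \<in> powsp sc V m"
        using V(2,4) by blast
      thus "1 \<in> {r \<in> powsp sc V 0. dn r \<in> powsp sc V (0 + m)}"
        using powsp_prod_listI[of "[]" 0 V] by simp
      fix n c t assume c: "c \<in> V" and t: "t \<in> {r \<in> powsp sc V n. dn r \<in> powsp sc V (n + m)}"
      have cV: "c \<in> powsp sc V 1"
        using c by (rule powsp_base)
      have "tau c * dn t \<in> powsp sc V (1 + (n + m))"
        using t by (intro powsp_mult tau_powsp cV) simp
      moreover have "dn c * t \<in> powsp sc V (m + n)"
        using t c V(4) by (intro powsp_mult) auto
      hence "dn c * t \<in> powsp sc V (1 + (n + m))"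
        using powsp_mono_exp[OF V(2), of "m + n" "1 + (n + m)"] by auto
      ultimately have "dn (c * t) \<in> powsp sc V (Suc n + m)"
        using dn_mult[OF VR[OF cV] VR[of t n]] t subspace_add[OF subspace_powsp] by simp
      moreover have "c * t \<in> powsp sc V (Suc n)"
        using powsp_mult[OF cV, of t n] t by simp
      ultimately show "c * t \<in> {r \<in> powsp sc V (Suc n). dn r \<in> powsp sc V (Suc n + m)}"
        by simp
    qed
    thus ?thesis
      using that by blast
  qed
  have E_base: "r * xn ^ i \<in> E n" if "r \<in> powsp sc V N" "N \<le> (m + 1) * n" "i \<le> n" for r N i n
    unfolding E_def using that powsp_mono_exp[OF V(2) that(2)] by (intro span_base) blast
  have "powsp sc (insert xn V) n \<subseteq> E n"
  proof (rule powsp_subsetI)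
    show "subspace (E n)" for n
      by (simp add: E_def)
    show "1 \<in> E 0"
      using E_base[of 1 0 0 0] powsp_prod_listI[of "[]" 0 V] by simp
    fix n c t assume c: "c \<in> insert xn V" and t: "t \<in> E n"
    have "{r * xn ^ i | r i. r \<in> powsp sc V ((m + 1) * n) \<and> i \<le> n} \<subseteq> {t. c * t \<in> E (Suc n)}"
    proof safe
      fix r i assume r: "r \<in> powsp sc V ((m + 1) * n)" and i: "i \<le> n"
      show "c * (r * xn ^ i) \<in> E (Suc n)"
      proof (cases "c = xn")
        case True
        have "c * (r * xn ^ i) = tau r * xn ^ Suc i + dn r * xn ^ i"
          using xn_comm[OF VR[OF r]] unfolding True by (simp add: mult.assoc[symmetric] distrib_right)
        moreover have "tau r * xn ^ Suc i \<in> E (Suc n)"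
          using tau_powsp[OF r] i by (intro E_base) auto
        moreover have "dn r * xn ^ i \<in> E (Suc n)"
          using dn_powsp[OF r] i by (intro E_base) auto
        ultimately show ?thesis
          unfolding E_def using span_add by presburger
      next
        case False
        hence "c * r \<in> powsp sc V (1 + (m + 1) * n)"
          using c r by (intro powsp_mult powsp_base) auto
        hence "c * r * xn ^ i \<in> E (Suc n)"
          using i by (intro E_base) auto
        thus ?thesis
          by (simp add: mult.assoc)
      qed
    qed
    hence "E n \<subseteq> {t. c * t \<in> E (Suc n)}"
      unfolding E_def[of n] by (rule span_minimal) (simp add: subspace_mult_left E_def)
    thus "c * t \<in> E (Suc n)"
      using t by blast
  qed
  thus ?thesis
    by (simp add: E_def)
qed

text \<open>Take the union of finite sets with \<open>tau\<close>-stable span, one around each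
  generator, and add 1, which \<open>tau\<close> fixes. The union of the powers of this
  \<open>V\<close> is a subalgebra containing the generators, hence contains R.\<close>

lemma tau_stable_generators:
  assumes "fin_gen sc R"
  obtains V where "finite V" "V \<subseteq> R" "1 \<in> V" "tau ` V \<subseteq> span V" "R \<subseteq> (\<Union>n. powsp sc V n)"
proof -
  obtain G where G: "finite G" "G \<subseteq> R" "R = \<Inter>{B. subalg sc B \<and> G \<subseteq> B}"
    using assms unfolding fin_gen_def by blast
  have "\<forall>g\<in>G. \<exists>B. finite B \<and> B \<subseteq> R \<and> g \<in> span B \<and> (\<forall>t\<in>B. tau t \<in> span B)"
    using tau_locally_finite G(2) by blast
  then obtain W where W: "\<And>g. g \<in> G \<Longrightarrow> finite (W g) \<and> W g \<subseteq> R \<and> g \<in> span (W g) \<and>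
      (\<forall>t\<in>W g. tau t \<in> span (W g))"
    by metis
  define V where "V = insert 1 (\<Union>g\<in>G. W g)"
  have sub: "span (W g) \<subseteq> span V" if "g \<in> G" for g
    using that by (intro span_mono) (auto simp: V_def)
  have "tau 1 = 1"
    by (simp add: tau_eq S_b_b)
  hence "tau ` V \<subseteq> span V"
    using W sub span_base[of 1 V] by (force simp: V_def)
  moreover have "G \<subseteq> span V"
    using W sub by blast
  hence "G \<subseteq> powsp sc V 1"
    using powsp_base[of _ "span V"] by (auto simp: powsp_span)
  hence "R \<subseteq> (\<Union>n. powsp sc V n)"
    using subalg_Union_powsp[of V] by (subst G(3)) (rule Inter_lower, auto simp: V_def)
  ultimately show ?thesis
    using that[of V] W G(1) by (auto simp: V_def)
qed

lemma GKdim_UNIV_ge: "GKdim sc R + 1 \<le> GKdim sc UNIV"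
proof -
  let ?L = "\<lambda>B. limsup (\<lambda>n. ereal (ln (real (dim (powsp sc (span B) n))) / ln (real n)))"
  have "GKdim sc R + 1 = (SUP B\<in>{B. finite B \<and> B \<subseteq> R \<and> 1 \<in> B}. ?L B + 1)"
    \<comment> \<open>The set \<open>{1}\<close> shows that the supremum ranges over a nonempty
      family, so the constant 1 can be moved inside.\<close>
    unfolding GKdim_def by (rule SUP_ereal_add_left[symmetric]) (auto intro!: exI[of _ "{1}"])
  also have "\<dots> \<le> GKdim sc UNIV"
  proof (rule SUP_least)
    fix B assume B: "B \<in> {B. finite B \<and> B \<subseteq> R \<and> 1 \<in> B}"
    have "?L B + 1 \<le> ?L (insert x B)"
      unfolding powsp_span using B
      by (intro limsup_log_lower dim_powsp_insert_x dim_powsp_pos) auto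
    also have "\<dots> \<le> GKdim sc UNIV"
      unfolding GKdim_def using B by (intro SUP_upper) auto
    finally show "?L B + 1 \<le> GKdim sc UNIV" .
  qed
  finally show ?thesis .
qed

text \<open>\<open>V\<close> and \<open>xn\<close> generate T, so every finite \<open>B\<close> lies
  in a fixed power \<open>k\<close> of their span. Its growth is then bounded by that of
  \<open>V\<close>, which is a competitor in \<open>GKdim sc R\<close>, up to a linear
  factor.\<close>

lemma GKdim_UNIV_le:
  assumes "fin_gen sc R"
  shows "GKdim sc UNIV \<le> GKdim sc R + 1"
proof -
  let ?L = "\<lambda>B. limsup (\<lambda>n. ereal (ln (real (dim (powsp sc (span B) n))) / ln (real n)))"
  obtain V where V: "finite V" "V \<subseteq> R" "1 \<in> V" "tau ` V \<subseteq> span V" "R \<subseteq> (\<Union>n. powsp sc V n)"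
    using tau_stable_generators[OF assms] by metis
  have "dn ` V \<subseteq> (\<Union>n. powsp sc V n)"
    using V(2,5) dn_R by blast
  then obtain m where m: "dn ` V \<subseteq> powsp sc V m"
    using finite_subset_powsp[OF V(3)] V(1) by blast
  define U where "U = (\<Union>n. powsp sc (insert xn V) n)"
  have U: "subalg sc U"
    unfolding U_def using V(3) by (intro subalg_Union_powsp) simp
  have U_add: "s + t \<in> U" and U_mult: "s * t \<in> U" if "s \<in> U" "t \<in> U" for s t
    using U that by (auto simp: subalg_def)
  have RU: "R \<subseteq> U"
    unfolding U_def using V(5) powsp_mono[of V "insert xn V"] by blast
  have "xn \<in> U"
    unfolding U_def using powsp_base[of xn "insert xn V"] by blast
  \<comment> \<open>The old variable is recovered as \<open>b * xn\<close> with \<open>b\<close> in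
    R.\<close>
  hence xU: "x \<in> U"
    using U_mult[of b xn] subsetD[OF RU abR(2)] by (simp add: b_xn)
  have powU: "x ^ i \<in> U" for i
    by (induction i) (use U xU U_mult in \<open>auto simp: subalg_def\<close>)
  have U_UNIV: "t \<in> U" for t
  proof -
    obtain n c where c: "\<forall>i<n. c i \<in> R" "t = (\<Sum>i<n. c i * x ^ i)"
      using ore unfolding ore_ext_def by meson
    have "(\<Sum>i\<in>I. c i * x ^ i) \<in> U" if "I \<subseteq> {..<n}" for I
      using finite_subset[OF that finite_lessThan] that
      by (induction I) (use U U_add U_mult powU RU c(1) in \<open>auto simp: subalg_def\<close>)
    thus ?thesis
      using c(2) by blast
  qed
  have "?L B \<le> ?L V + 1" if B: "finite B" "1 \<in> B" for B
  proof -
    obtain k where k: "k \<ge> 1" "B \<subseteq> powsp sc (insert xn V) k"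
      using finite_subset_powsp[of "insert xn V" B] V(3) B(1) U_UNIV unfolding U_def by blast
    \<comment> \<open>The \<open>n\<close>-th power of \<open>B\<close> lies in power k n of the
      generators, whose normal form has degree at most k n in \<open>xn\<close> and coefficients in
      power (m + 1) k n of \<open>V\<close>.\<close>
    have "dim (powsp sc B n) \<le> (k * n + 1) * dim (powsp sc V ((m + 1) * k * n))" for n
    proof (rule dim_mult_powers_le[OF V(1)])
      have "powsp sc B n \<subseteq> powsp sc (insert xn V) (k * n)"
        by (rule powsp_compose[OF k(2)])
      also have "\<dots> \<subseteq> span {r * xn ^ i | r i. r \<in> powsp sc V ((m + 1) * (k * n)) \<and> i \<le> k * n}"
        by (rule powsp_insert_xn[OF V(2,3,4) m])
      finally show "powsp sc B n \<subseteq>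
          span {r * xn ^ i | r i. r \<in> powsp sc V ((m + 1) * k * n) \<and> i \<le> k * n}"
        by (simp only: mult.assoc)
    qed
    thus ?thesis
      unfolding powsp_span using k(1) V(1,3) B
      by (intro limsup_log_upper[of _ k _ "(m + 1) * k"] dim_powsp_pos) auto
  qed
  moreover have "?L V \<le> GKdim sc R"
    unfolding GKdim_def using V by (intro SUP_upper) auto
  ultimately have "?L B \<le> GKdim sc R + 1" if "finite B" "1 \<in> B" for B
    using that by (meson add_right_mono order_trans)
  thus ?thesis
    unfolding GKdim_def[of sc UNIV] by (intro SUP_least) auto
qed

end

theorem theorem2p6:
  fixes sc :: "'f::field \<Rightarrow> 'a::ring_1 \<Rightarrow> 'a"
    and D :: "'a \<Rightarrow> ('a \<times> 'a) list" and e :: "'a \<Rightarrow> 'f" and S :: "'a \<Rightarrow> 'a"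
    and R :: "'a set" and \<sigma> \<delta> :: "'a \<Rightarrow> 'a" and x \<alpha> \<beta> :: 'a
  assumes "hopf_ore_ext sc D e S R \<sigma> \<delta> x"
    and "fin_gen sc R"
    and "\<alpha> \<in> R" and "\<beta> \<in> R"
    and "\<exists>\<alpha>'\<in>R. \<alpha> * \<alpha>' = 1 \<and> \<alpha>' * \<alpha> = 1"
    and "S x = \<alpha> * x + \<beta>"
  shows "GKdim sc UNIV = GKdim sc R + 1"
proof -
  obtain \<alpha>' where inv: "\<alpha>' \<in> R" "\<alpha> * \<alpha>' = 1" "\<alpha>' * \<alpha> = 1"
    using assms(5) by blast
  have ext: "hopf_alg sc D e S" "hopf_subalg sc D S R" "alg_aut_on sc R \<sigma>"
    "sigma_deriv_on sc R \<sigma> \<delta>" "ore_ext R \<sigma> \<delta> x"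
    using assms(1) by (simp_all add: hopf_ore_ext_def)
  obtain a b v w where abvw: "a \<in> R" "b \<in> R" "set v \<subseteq> R \<times> R" "set w \<subseteq> R \<times> R"
    "teq sc (D x) ([(a, x), (x, b)] @ map (\<lambda>p. (fst p * x, snd p * x)) v @ w)"
    using assms(1) unfolding hopf_ore_ext_def by blast
  interpret hopf_ore sc D e S R \<sigma> \<delta> x \<alpha> \<alpha>' \<beta> a b v w
    by unfold_locales (use ext abvw inv assms in \<open>auto simp: hopf_alg_def\<close>)
  show ?thesis
    using GKdim_UNIV_ge GKdim_UNIV_le[OF assms(2)] by (rule antisym[rotated])
qed

end
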